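(* Let $\Delta$ be a thick polar space of rank $3$, let $p,b$ be two opposite points of $\Delta$, and let $\Gamma$ be the generalized quadrangle $p^\perp\cap b^\perp$. Then all roots of the second kind of $\Gamma$ are Moufang. Furthermore, every line elation of $\Gamma$ can be written as a self-projectivity of length $4$; that is, for every line elation $\theta$ of $\Gamma$ there are points $p_0=p,p_1,p_2,p_3,p_4=p$ of $\Delta$ with $p_{i-1}$ opposite $p_i$ for $i=1,\dots,4$ such that, under the identification of $\Gamma$ with $\mathrm{Res}_\Delta(p)$ given by $x\mapsto px$, $\theta$ is the collineation $\mathrm{proj}^{p_3}_{p_4}\circ\mathrm{proj}^{p_2}_{p_3}\circ\mathrm{proj}^{p_1}_{p_2}\circ\mathrm{proj}^{p_0}_{p_1}$.
   Context: A point-line geometry is a set of points with a set of lines (subsets of the point set). Points $x,y$ on a common line are collinear, $x\perp y$ (each point is collinear to itself); $x^\perp$ is the set of points collinear to $x$. A (non-degenerate) polar space is a point-line geometry in which every line has at least three points and, for every point $x$, $x^\perp$ is a proper subspace (closed under lines meeting it in at least two points, not everything) meeting every line. Singular subspaces are subspaces of pairwise collinear points. Rank $3$: the maximal singular subspaces are projective planes. Thick: every line is contained in at least three planes. Two points are opposite if not collinear. For opposite points $p,b$, the set $p^\perp\cap b^\perp$ with the lines contained in it is a thick generalized quadrangle (polar space of rank 2). Residues and projectivities. For a point $p$, $\mathrm{Res}_\Delta(p)$ is the geometry whose points are the lines of $\Delta$ through $p$ and whose lines are the planes of $\Delta$ through $p$. For opposite points $p,b$, $\mathrm{proj}^p_b:\mathrm{Res}_\Delta(p)\to\mathrm{Res}_\Delta(b)$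 maps a line $K$ through $p$ to the line $bu'$, where $u'$ is the unique point of $K$ collinear to $b$. A composition $\mathrm{proj}^{p_{s-1}}_{p_s}\circ\cdots\circ\mathrm{proj}^{p_0}_{p_1}$ (consecutive points opposite) is a projectivity of length $s$; it is a self-projectivity if $p_s=p_0$. The map $x\mapsto px$ is an isomorphism $\Gamma\to\mathrm{Res}_\Delta(p)$ for $\Gamma=p^\perp\cap b^\perp$. Roots of the second kind in $\Gamma$. An apartment of $\Gamma$ is an ordinary quadrangle: four points $d,q,u,n$ with $d\perp q\perp u\perp n\perp d$, $d\not\perp u$, $q\not\perp n$, together with the four lines $dq,qu,un,nd$. A root of the second kind in this apartment is $\alpha=\{d,q,dq,dn,qu\}$, with interior $\alpha^+=\{d,q,dq\}$. The root $\alpha$ is Moufang if the group of collineations of $\Gamma$ fixing every point of $dq$ and stabilizing every line through $d$ or through $q$ acts transitively on the set of apartments of $\Gamma$ containing $\alpha$. A line elation of $\Gamma$ (with center $(d,dq,q)$, for distinct collinear points $d,q$) is a collineation of $\Gamma$ fixing all points of $dq$ and stabilizing all lines through $d$ or $q$. A collineation is a permutation of points inducing a permutation of lines. *)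

theory Defs
  imports "HOL-Combinatorics.Permutations" "HOL-Library.FuncSet"
begin

section \<open>Point-line geometries\<close>

record 'a geometry =
  points :: "'a set"
  lines :: "'a set set"

definition point_line_geometry :: "'a geometry \<Rightarrow> bool" where
  "point_line_geometry G \<longleftrightarrow> (\<forall>l\<in>lines G. l \<subseteq> points G)"

definition collinear :: "'a geometry \<Rightarrow> 'a \<Rightarrow> 'a \<Rightarrow> bool" where
  "collinear G x y \<longleftrightarrow> x \<in> points G \<and> y \<in> points G \<and>
     (x = y \<or> (\<exists>l\<in>lines G. x \<in> l \<and> y \<in> l))"

definition perp :: "'a geometry \<Rightarrow> 'a \<Rightarrow> 'a set" where
  "perp G x = {y. collinear G x y}"

definition opposite :: "'a geometry \<Rightarrow> 'a \<Rightarrow> 'a \<Rightarrow> bool" where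
  "opposite G x y \<longleftrightarrow> x \<in> points G \<and> y \<in> points G \<and> \<not> collinear G x y"

text \<open>Only used for distinct collinear points of a polar space or of a generalized quadrangle
  in it. Uniqueness of the line is not an axiom below, but a theorem on non-degenerate
  polar spaces (Buekenhout and Shult).\<close>

definition join :: "'a geometry \<Rightarrow> 'a \<Rightarrow> 'a \<Rightarrow> 'a set" where
  "join G x y = (THE l. l \<in> lines G \<and> x \<in> l \<and> y \<in> l)"

definition is_subspace :: "'a geometry \<Rightarrow> 'a set \<Rightarrow> bool" where
  "is_subspace G S \<longleftrightarrow> S \<subseteq> points G \<and>
     (\<forall>l\<in>lines G. (\<exists>x\<in>l \<inter> S. \<exists>y\<in>l \<inter> S. x \<noteq> y) \<longrightarrow> l \<subseteq> S)"

definition induced :: "'a geometry \<Rightarrow> 'a set \<Rightarrow> 'a geometry" where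
  "induced G S = \<lparr>points = S, lines = {l \<in> lines G. l \<subseteq> S}\<rparr>"

definition singular_subspace :: "'a geometry \<Rightarrow> 'a set \<Rightarrow> bool" where
  "singular_subspace G S \<longleftrightarrow> is_subspace G S \<and> (\<forall>x\<in>S. \<forall>y\<in>S. collinear G x y)"

definition maximal_singular_subspace :: "'a geometry \<Rightarrow> 'a set \<Rightarrow> bool" where
  "maximal_singular_subspace G M \<longleftrightarrow> singular_subspace G M \<and>
     (\<forall>S. singular_subspace G S \<and> M \<subseteq> S \<longrightarrow> S = M)"

definition projective_plane :: "'a geometry \<Rightarrow> bool" where
  "projective_plane G \<longleftrightarrow> point_line_geometry G \<and>
     (\<forall>x\<in>points G. \<forall>y\<in>points G. x \<noteq> y \<longrightarrow> (\<exists>!l. l \<in> lines G \<and> x \<in> l \<and> y \<in> l)) \<and>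
     (\<forall>l\<in>lines G. \<forall>m\<in>lines G. l \<noteq> m \<longrightarrow> (\<exists>!x. x \<in> l \<and> x \<in> m)) \<and>
     (\<exists>w x y z. {w, x, y, z} \<subseteq> points G \<and> distinct [w, x, y, z] \<and>
        (\<forall>l\<in>lines G. \<not> {w, x, y} \<subseteq> l \<and> \<not> {w, x, z} \<subseteq> l \<and> \<not> {w, y, z} \<subseteq> l \<and> \<not> {x, y, z} \<subseteq> l))"

definition is_plane :: "'a geometry \<Rightarrow> 'a set \<Rightarrow> bool" where
  "is_plane G S \<longleftrightarrow> singular_subspace G S \<and> projective_plane (induced G S)"


section \<open>Thick polar spaces of rank 3\<close>

definition polar_space :: "'a geometry \<Rightarrow> bool" where
  "polar_space G \<longleftrightarrow> point_line_geometry G \<and>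
     (\<forall>l\<in>lines G. \<exists>x\<in>l. \<exists>y\<in>l. \<exists>z\<in>l. distinct [x, y, z]) \<and>
     (\<forall>x\<in>points G. is_subspace G (perp G x) \<and> perp G x \<noteq> points G \<and>
        (\<forall>l\<in>lines G. l \<inter> perp G x \<noteq> {}))"

definition rank_three :: "'a geometry \<Rightarrow> bool" where
  "rank_three G \<longleftrightarrow> (\<forall>M. maximal_singular_subspace G M \<longrightarrow> projective_plane (induced G M))"

definition thick :: "'a geometry \<Rightarrow> bool" where
  "thick G \<longleftrightarrow> (\<forall>l\<in>lines G. \<exists>A B C. distinct [A, B, C] \<and>
     (\<forall>S\<in>{A, B, C}. is_plane G S \<and> l \<subseteq> S))"

definition perp_quadrangle :: "'a geometry \<Rightarrow> 'a \<Rightarrow> 'a \<Rightarrow> 'a geometry" where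
  "perp_quadrangle G p b = induced G (perp G p \<inter> perp G b)"


section \<open>Residues and projections\<close>

text \<open>A plane through \<open>p\<close> is represented by the set of lines through \<open>p\<close> that it contains.\<close>

definition residue :: "'a geometry \<Rightarrow> 'a \<Rightarrow> 'a set geometry" where
  "residue G p = \<lparr>points = {K \<in> lines G. p \<in> K},
     lines = {{K \<in> lines G. p \<in> K \<and> K \<subseteq> S} | S. is_plane G S \<and> p \<in> S}\<rparr>"

text \<open>\<open>proj G p b\<close> is meant for opposite \<open>p\<close> and \<open>b\<close>, and maps \<open>residue G p\<close> to \<open>residue G b\<close>.\<close>

definition proj :: "'a geometry \<Rightarrow> 'a \<Rightarrow> 'a \<Rightarrow> 'a set \<Rightarrow> 'a set" where
  "proj G p b = (\<lambda>K\<in>points (residue G p). join G b (THE u. u \<in> K \<and> collinear G u b))"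


section \<open>Collineations, apartments and roots\<close>

text \<open>A collineation is extended by the identity outside the point set, as usual for \<open>permutes\<close>.\<close>

definition collineation :: "'a geometry \<Rightarrow> ('a \<Rightarrow> 'a) \<Rightarrow> bool" where
  "collineation G \<theta> \<longleftrightarrow> \<theta> permutes points G \<and> bij_betw ((`) \<theta>) (lines G) (lines G)"

definition line_elation :: "'a geometry \<Rightarrow> 'a \<Rightarrow> 'a \<Rightarrow> ('a \<Rightarrow> 'a) \<Rightarrow> bool" where
  "line_elation G d q \<theta> \<longleftrightarrow> d \<noteq> q \<and> collinear G d q \<and> collineation G \<theta> \<and>
     (\<forall>x\<in>join G d q. \<theta> x = x) \<and>
     (\<forall>l\<in>lines G. d \<in> l \<or> q \<in> l \<longrightarrow> \<theta> ` l = l)"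

definition quadrangle :: "'a geometry \<Rightarrow> 'a \<Rightarrow> 'a \<Rightarrow> 'a \<Rightarrow> 'a \<Rightarrow> bool" where
  "quadrangle G d q u n \<longleftrightarrow>
     collinear G d q \<and> collinear G q u \<and> collinear G u n \<and> collinear G n d \<and>
     \<not> collinear G d u \<and> \<not> collinear G q n"

text \<open>Apartments and roots are sets of points (\<open>Inl\<close>) and lines (\<open>Inr\<close>).\<close>

definition apartment :: "'a geometry \<Rightarrow> 'a \<Rightarrow> 'a \<Rightarrow> 'a \<Rightarrow> 'a \<Rightarrow> ('a + 'a set) set" where
  "apartment G d q u n =
     {Inl d, Inl q, Inl u, Inl n,
      Inr (join G d q), Inr (join G q u), Inr (join G u n), Inr (join G n d)}"

definition apartments :: "'a geometry \<Rightarrow> ('a + 'a set) set set" where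
  "apartments G = {apartment G d q u n | d q u n. quadrangle G d q u n}"

definition second_kind_root :: "'a geometry \<Rightarrow> 'a \<Rightarrow> 'a \<Rightarrow> 'a \<Rightarrow> 'a \<Rightarrow> ('a + 'a set) set" where
  "second_kind_root G d q u n =
     {Inl d, Inl q, Inr (join G d q), Inr (join G d n), Inr (join G q u)}"

text \<open>The group in the Moufang condition for this root is exactly the set of line elations
  with center \<open>(d, dq, q)\<close>.\<close>

definition moufang_second_kind_root :: "'a geometry \<Rightarrow> 'a \<Rightarrow> 'a \<Rightarrow> 'a \<Rightarrow> 'a \<Rightarrow> bool" where
  "moufang_second_kind_root G d q u n \<longleftrightarrow>
     (\<forall>A\<in>apartments G. \<forall>B\<in>apartments G.
        second_kind_root G d q u n \<subseteq> A \<and> second_kind_root G d q u n \<subseteq> B \<longrightarrow>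
        (\<exists>\<theta>. line_elation G d q \<theta> \<and> map_sum \<theta> ((`) \<theta>) ` A = B))"

end

theory Submission
  imports Defs
begin

text \<open>Let \<open>d\<close>, \<open>q\<close> be distinct collinear points of \<open>\<Gamma>\<close>. For \<open>r \<noteq> d\<close> on the line \<open>pd\<close> and
  \<open>s \<noteq> q\<close> on the line \<open>bq\<close>, the projectivity \<open>p \<rightarrow> b \<rightarrow> r \<rightarrow> s \<rightarrow> p\<close> is a line elation with center
  \<open>(d, dq, q)\<close>: the line \<open>dq\<close> is collinear to all of \<open>p\<close>, \<open>b\<close>, \<open>r\<close>, \<open>s\<close>, while a plane through
  \<open>pd\<close> is stabilized because \<open>rd = pd\<close>, and one through \<open>pq\<close> because \<open>sq = bq\<close>. For points
  \<open>u\<close>, \<open>v\<close> other than \<open>q\<close> on a line of \<open>\<Gamma>\<close> through \<open>q\<close> different from \<open>dq\<close>, fix \<open>r \<noteq> p\<close> and let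
  \<open>y\<close> be the point of \<open>bu\<close> collinear to \<open>r\<close>. In the plane \<open>\<langle>b, q, u\<rangle>\<close> the line \<open>vy\<close> meets \<open>bq\<close> in a
  point \<open>s\<close>, and the resulting elation maps \<open>u\<close> to \<open>v\<close>. This is the Moufang property, and since
  a line elation of a thick generalized quadrangle is determined by the image of \<open>u\<close>, every line
  elation arises in this way.\<close>

section \<open>Lines of a polar space\<close>

lemma join_commute: "join G x y = join G y x"
  unfolding join_def by (metis (no_types, lifting))

lemma collinear_sym: "collinear G x y \<Longrightarrow> collinear G y x"
  by (auto simp: collinear_def)

lemma collinear_points: "collinear G x y \<Longrightarrow> x \<in> points G \<and> y \<in> points G"
  by (auto simp: collinear_def)

lemma collinear_refl: "x \<in> points G \<Longrightarrow> collinear G x x"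
  by (auto simp: collinear_def)

locale nondeg_polar =
  fixes \<Delta> :: "'a geometry"
  assumes polar: "polar_space \<Delta>"
begin

abbreviation perp_rel :: "'a \<Rightarrow> 'a \<Rightarrow> bool" (infix "\<sim>" 50)
  where "x \<sim> y \<equiv> collinear \<Delta> x y"

lemma perp_sym: "x \<sim> y \<Longrightarrow> y \<sim> x"
  by (rule collinear_sym)

lemma line_in_points: "l \<in> lines \<Delta> \<Longrightarrow> x \<in> l \<Longrightarrow> x \<in> points \<Delta>"
  using polar by (auto simp: polar_space_def point_line_geometry_def)

lemma line_collinear: "l \<in> lines \<Delta> \<Longrightarrow> x \<in> l \<Longrightarrow> y \<in> l \<Longrightarrow> x \<sim> y"
  using line_in_points by (auto simp: collinear_def)

text \<open>The points \<open>x\<close> and \<open>y\<close> are arbitrary, possibly equal or off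
  \<open>l\<close>; later choices of auxiliary points use this avoidance form.\<close>

lemma third_point:
  assumes "l \<in> lines \<Delta>"
  shows "\<exists>z\<in>l. z \<noteq> x \<and> z \<noteq> y"
proof -
  have "\<forall>l\<in>lines \<Delta>. \<exists>x\<in>l. \<exists>y\<in>l. \<exists>z\<in>l. distinct [x, y, z]"
    using polar by (simp add: polar_space_def)
  with assms obtain u v w where "u \<in> l" "v \<in> l" "w \<in> l" "u \<noteq> v" "u \<noteq> w" "v \<noteq> w"
    by auto
  then show ?thesis by (cases "u = x \<or> u = y"; cases "v = x \<or> v = y") auto
qed

text \<open>The "all" half of the one-or-all property, from perps being subspaces;
  \<open>perp_meets\<close> is the "at least one" half.\<close>

lemma perp_line:
  assumes "l \<in> lines \<Delta>" "x \<in> l" "y \<in> l" "x \<noteq> y" "a \<sim> x" "a \<sim> y" "z \<in> l"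
  shows "a \<sim> z"
proof -
  have "is_subspace \<Delta> (perp \<Delta> a)"
    using polar collinear_points[OF assms(5)] by (auto simp: polar_space_def)
  then have "l \<subseteq> perp \<Delta> a"
    using assms unfolding is_subspace_def perp_def by blast
  with assms show ?thesis by (auto simp: perp_def)
qed

lemma perp_meets: "l \<in> lines \<Delta> \<Longrightarrow> a \<in> points \<Delta> \<Longrightarrow> \<exists>x\<in>l. a \<sim> x"
  using polar by (fastforce simp: polar_space_def perp_def)

lemma ex_non_collinear: "a \<in> points \<Delta> \<Longrightarrow> \<exists>t\<in>points \<Delta>. \<not> t \<sim> a"
proof -
  assume a: "a \<in> points \<Delta>"
  then have "perp \<Delta> a \<noteq> points \<Delta>" using polar by (auto simp: polar_space_def)
  moreover have "perp \<Delta> a \<subseteq> points \<Delta>" by (auto simp: perp_def collinear_def)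
  ultimately show ?thesis by (auto simp: perp_def dest: perp_sym)
qed

section \<open>Existence and uniqueness of the line through two collinear points\<close>

lemma ex_line: "x \<sim> y \<Longrightarrow> x \<noteq> y \<Longrightarrow> \<exists>l\<in>lines \<Delta>. x \<in> l \<and> y \<in> l"
  by (auto simp: collinear_def)

lemma perp_line_unique:
  assumes "l \<in> lines \<Delta>" "x \<in> l" "y \<in> l" "a \<sim> x" "a \<sim> y" "z \<in> l" "\<not> a \<sim> z"
  shows "x = y"
  using perp_line assms by blast

text \<open>Here \<open>yl\<close> puts \<open>y\<close> in the double perp of \<open>l\<close>, and
  \<open>opp\<close> forbids a point of \<open>h\<close> from being collinear to two points of
  \<open>l\<close>. The conclusion puts \<open>y\<close> in the radical, which non-degeneracy
  excludes; \<open>lines_subset\<close> draws its contradiction from this.\<close>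

lemma radical_of_opposite_lines:
  assumes l: "l \<in> lines \<Delta>" and h: "h \<in> lines \<Delta>"
    and yl: "\<And>t. (\<And>e. e \<in> l \<Longrightarrow> t \<sim> e) \<Longrightarrow> t \<sim> y"
    and yh: "\<And>g. g \<in> h \<Longrightarrow> g \<sim> y"
    and opp: "\<And>g e e'. g \<in> h \<Longrightarrow> e \<in> l \<Longrightarrow> e' \<in> l \<Longrightarrow> e \<noteq> e' \<Longrightarrow> e \<sim> g \<Longrightarrow> \<not> e' \<sim> g"
    and s: "s \<in> points \<Delta>"
  shows "s \<sim> y"
proof -
  obtain e where e: "e \<in> l" "s \<sim> e" using perp_meets[OF l s] by blast
  obtain g where g: "g \<in> h" "e \<sim> g" using perp_meets[OF h] line_in_points[OF l] e by blast
  obtain e' where e': "e' \<in> l" "e' \<noteq> e" using third_point[OF l] by blast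
  have ng: "\<not> e' \<sim> g" using opp g e e' by blast
  have y_l: "y \<sim> x" if "x \<in> l" for x
    by (rule perp_sym, rule yl) (rule line_collinear[OF l that])
  \<comment> \<open>On the line \<open>s'g\<close> the point \<open>f\<close> collinear to
    \<open>e'\<close> is also collinear to \<open>e\<close>, hence to all of \<open>l\<close> and to
    \<open>y\<close>. So \<open>y\<close> is collinear to \<open>f\<close> and \<open>g\<close>, and
    therefore to \<open>s'\<close>.\<close>
  have claim: "s' \<sim> y" if s': "s' \<sim> e" "s' \<sim> g" for s'
  proof (cases "s' = g")
    case True then show ?thesis using yh g by simp
  next
    case False
    then obtain k where k: "k \<in> lines \<Delta>" "s' \<in> k" "g \<in> k" using ex_line s' by blast
    obtain f where f: "f \<in> k" "e' \<sim> f" using perp_meets[OF k(1)] line_in_points[OF l] e' by blast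
    have "e \<sim> f" using perp_line[OF k False] s' g f perp_sym by metis
    then have "f \<sim> x" if "x \<in> l" for x
      using perp_line[OF l e(1) e'(1) _ _ _ that] e' f perp_sym by metis
    then have "f \<sim> y" by (rule yl)
    moreover have "f \<noteq> g" using ng f by blast
    ultimately show ?thesis
      using perp_line[OF k(1) f(1) k(3)] yh[OF g(1)] k(2) perp_sym by metis
  qed
  \<comment> \<open>For general \<open>s\<close>, the claim is applied to the point
    \<open>s'\<close> collinear to \<open>g\<close> on a line joining \<open>s\<close> to a point
    \<open>x\<close> of \<open>e'y\<close>: as \<open>e\<close> is collinear to \<open>s\<close> and
    \<open>x\<close>, it is collinear to \<open>s'\<close>.\<close>
  have "y \<noteq> e'" using ng yh[OF g(1)] perp_sym by metis
  then obtain m where m: "m \<in> lines \<Delta>" "e' \<in> m" "y \<in> m" using ex_line y_l e' by blast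
  obtain x where x: "x \<in> m" "s \<sim> x" using perp_meets[OF m(1) s] by blast
  have xe: "e \<sim> x"
    using perp_line[OF m \<open>y \<noteq> e'\<close>[symmetric]] x(1) line_collinear[OF l e(1) e'(1)] y_l[OF e(1)]
      perp_sym by metis
  have xy: "x \<sim> y" using line_collinear m x by blast
  show ?thesis
  proof (cases "x = s \<or> x = y")
    case True then show ?thesis using xy x by blast
  next
    case False
    then obtain r where r: "r \<in> lines \<Delta>" "s \<in> r" "x \<in> r" using ex_line x by blast
    obtain s' where s': "s' \<in> r" "g \<sim> s'" using perp_meets[OF r(1)] line_in_points[OF h] g by blast
    have "e \<sim> s'" using perp_line[OF r] False e(2) xe s'(1) perp_sym by metis
    then have s'y: "s' \<sim> y" using claim s' perp_sym by metis
    have "s' \<noteq> x"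
    proof
      assume "s' = x"
      then have "g \<sim> e'"
        using perp_line[OF m(1) x(1) m(3) _ _ _ m(2)] False s'(2) yh[OF g(1)] by blast
      then show False using ng perp_sym by metis
    qed
    then show ?thesis
      using perp_line[OF r(1) s'(1) r(3)] s'y xy r(2) perp_sym by metis
  qed
qed

text \<open>A point \<open>z\<close> of \<open>m\<close> outside \<open>l\<close> would lie in \<open>l\<^sup>\<bottom>\<^sup>\<bottom>\<close>. From it a point \<open>y\<close> of
  \<open>l\<^sup>\<bottom>\<^sup>\<bottom>\<close> is constructed that is collinear to all points of a line \<open>h\<close> opposite \<open>l\<close>.\<close>

lemma lines_subset:
  assumes l: "l \<in> lines \<Delta>" and m: "m \<in> lines \<Delta>" and xy: "x \<noteq> y"
    and xl: "x \<in> l" "y \<in> l" and xm: "x \<in> m" "y \<in> m"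
  shows "m \<subseteq> l"
proof (rule ccontr)
  assume "\<not> m \<subseteq> l"
  then obtain z where z: "z \<in> m" "z \<notin> l" by blast
  have zp: "z \<in> points \<Delta>" using line_in_points m z by blast
  have zl: "t \<sim> z" if "\<And>e. e \<in> l \<Longrightarrow> t \<sim> e" for t
    using perp_line[OF m xm xy] that xl z by blast
  have z_l: "e \<sim> z" if "e \<in> l" for e
    using zl line_collinear[OF l] that by blast
  obtain t0 where t0: "t0 \<in> points \<Delta>" "\<not> t0 \<sim> z" using ex_non_collinear zp by blast
  obtain a where a: "a \<in> l" "t0 \<sim> a" using perp_meets[OF l t0(1)] by blast
  have t0a: "\<not> t0 \<sim> e" if "e \<in> l" "e \<noteq> a" for e
    using zl t0(2) perp_line[OF l] a that by metis
  have ap: "a \<in> points \<Delta>" using line_in_points l a by blast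
  have "t0 \<noteq> a" using z_l a t0 by blast
  then obtain k where k: "k \<in> lines \<Delta>" "t0 \<in> k" "a \<in> k" using ex_line a by blast
  \<comment> \<open>The point \<open>t0\<close> is replaced by a point \<open>t\<close> of
    \<open>t0a\<close>, still collinear only to \<open>a\<close> on \<open>l\<close>, that lies on a
    line \<open>h\<close> leaving the perp of \<open>a\<close>.\<close>
  obtain w0 where w0: "w0 \<in> points \<Delta>" "\<not> w0 \<sim> a" using ex_non_collinear ap by blast
  obtain t where t: "t \<in> k" "w0 \<sim> t" using perp_meets[OF k(1) w0(1)] by blast
  have ta: "t \<noteq> a" "t \<sim> a" using t w0 line_collinear k by blast+
  have tz: "\<not> t \<sim> z"
    using perp_line[OF k(1) t(1) k(3) ta(1) _ _ k(2)] z_l[OF a(1)] t0(2) perp_sym by metis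
  have te: "\<not> t \<sim> e" if "e \<in> l" "e \<noteq> a" for e
    using perp_line[OF k(1) t(1) k(3) ta(1) _ _ k(2)] line_collinear[OF l that(1) a(1)]
      t0a[OF that] perp_sym by metis
  have "w0 \<noteq> t" using ta w0 by blast
  then obtain h where h: "h \<in> lines \<Delta>" "w0 \<in> h" "t \<in> h" using ex_line t by blast
  obtain w where w: "w \<in> h" "z \<sim> w" using perp_meets[OF h(1) zp] by blast
  have wt: "w \<noteq> t" using w tz perp_sym by metis
  have wa: "\<not> w \<sim> a"
    using perp_line[OF h(1) w(1) h(3) wt _ _ h(2)] ta w0 perp_sym by metis
  \<comment> \<open>As \<open>w\<close> is not collinear to \<open>a\<close>, the point
    \<open>c\<close> differs from \<open>a\<close>. All points of a line joining \<open>z\<close>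
    and \<open>c\<close> lie in the double perp of \<open>l\<close>; the one collinear to
    \<open>t\<close> is also collinear to \<open>w\<close>, hence to all of
    \<open>h\<close>.\<close>
  obtain c where c: "c \<in> l" "w \<sim> c" using perp_meets[OF l] line_in_points h w by blast
  have ca: "c \<noteq> a" using wa c by blast
  have zc: "z \<noteq> c" using z c by blast
  then obtain m' where m': "m' \<in> lines \<Delta>" "z \<in> m'" "c \<in> m'"
    using ex_line z_l[OF c(1)] perp_sym by metis
  obtain y0 where y0: "y0 \<in> m'" "t \<sim> y0" using perp_meets[OF m'(1)] line_in_points h by blast
  have wy0: "w \<sim> y0" using perp_line[OF m' zc] w c y0 perp_sym by metis
  have y0h: "g \<sim> y0" if "g \<in> h" for g
    using perp_line[OF h(1) w(1) h(3) wt _ _ that] wy0 y0(2) perp_sym by metis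
  have y0l: "t' \<sim> y0" if "\<And>e. e \<in> l \<Longrightarrow> t' \<sim> e" for t'
    using perp_line[OF m' zc] zl that c y0 by blast
  \<comment> \<open>A point of \<open>h\<close> collinear to two points of \<open>l\<close> is
    collinear to \<open>a\<close> and \<open>c\<close>. The point \<open>c\<close> rules out
    \<open>t\<close>; any other such point would make all of \<open>h\<close>, including
    \<open>w\<close>, collinear to \<open>a\<close>.\<close>
  have opp: "\<not> e' \<sim> g" if g: "g \<in> h" "e \<in> l" "e' \<in> l" "e \<noteq> e'" "e \<sim> g" for g e e'
  proof
    assume "e' \<sim> g"
    then have gl: "g \<sim> x" if "x \<in> l" for x
      using perp_line[OF l g(2,3,4) _ _ that] g(5) perp_sym by metis
    show False
    proof (cases "g = t")
      case True then show False using te c ca gl by blast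
    next
      case False
      then show False
        using perp_line[OF h(1) g(1) h(3) False _ _ w(1)] gl[OF a(1)] ta wa perp_sym by metis
    qed
  qed
  obtain s where "s \<in> points \<Delta>" "\<not> s \<sim> y0"
    using ex_non_collinear[of y0] line_in_points m' y0 by blast
  moreover have "s \<sim> y0"
    using l h(1) y0l y0h opp \<open>s \<in> points \<Delta>\<close> by (rule radical_of_opposite_lines)
  ultimately show False by simp
qed

lemma line_unique:
  "l \<in> lines \<Delta> \<Longrightarrow> m \<in> lines \<Delta> \<Longrightarrow> x \<noteq> y \<Longrightarrow> x \<in> l \<Longrightarrow> y \<in> l \<Longrightarrow> x \<in> m \<Longrightarrow> y \<in> m \<Longrightarrow> l = m"
  using lines_subset[of l m x y] lines_subset[of m l x y] by blast

lemma join_eq: "l \<in> lines \<Delta> \<Longrightarrow> x \<in> l \<Longrightarrow> y \<in> l \<Longrightarrow> x \<noteq> y \<Longrightarrow> join \<Delta> x y = l"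
  unfolding join_def using line_unique by (intro the_equality) blast+

lemma join_line:
  assumes "x \<sim> y" "x \<noteq> y"
  shows "join \<Delta> x y \<in> lines \<Delta>" "x \<in> join \<Delta> x y" "y \<in> join \<Delta> x y"
proof -
  obtain l where "l \<in> lines \<Delta>" "x \<in> l" "y \<in> l" using ex_line assms by blast
  then show "join \<Delta> x y \<in> lines \<Delta>" "x \<in> join \<Delta> x y" "y \<in> join \<Delta> x y"
    using join_eq assms by metis+
qed

lemma perp_join: "x \<sim> y \<Longrightarrow> x \<noteq> y \<Longrightarrow> a \<sim> x \<Longrightarrow> a \<sim> y \<Longrightarrow> z \<in> join \<Delta> x y \<Longrightarrow> a \<sim> z"
  using perp_line[of "join \<Delta> x y" x y a z] join_line by blast

end

section \<open>Line elations of generalized quadrangles\<close>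

lemma apartment_rotate: "apartment G d q u n = apartment G q u n d"
  by (auto simp: apartment_def)

lemma apartment_reflect: "apartment G d q u n = apartment G d n u q"
  by (auto simp: apartment_def join_commute[of G])

lemma quadrangle_rotate: "quadrangle G d q u n \<Longrightarrow> quadrangle G q u n d"
  by (auto simp: quadrangle_def dest: collinear_sym)

lemma quadrangle_reflect: "quadrangle G d q u n \<Longrightarrow> quadrangle G d n u q"
  by (auto simp: quadrangle_def dest: collinear_sym)

text \<open>Apartments are unlabelled sets. Rotation brings \<open>d\<close> to the front;
  \<open>q\<close> is then a neighbour of \<open>d\<close>, the opposite corner not being collinear
  to \<open>d\<close>, and a reflection puts it second.\<close>

lemma apartment_at_flag:
  assumes A: "A \<in> apartments G" and dq: "Inl d \<in> A" "Inl q \<in> A" "d \<noteq> q" "collinear G d q"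
  obtains u n where "quadrangle G d q u n" "A = apartment G d q u n"
proof -
  obtain d1 q1 u1 n1 where 1: "quadrangle G d1 q1 u1 n1" "A = apartment G d1 q1 u1 n1"
    using A by (auto simp: apartments_def)
  have "\<exists>q2 u2 n2. quadrangle G d q2 u2 n2 \<and> A = apartment G d q2 u2 n2"
  proof -
    have "d = d1 \<or> d = q1 \<or> d = u1 \<or> d = n1" using dq(1) 1 by (auto simp: apartment_def)
    then show ?thesis using 1 quadrangle_rotate apartment_rotate by metis
  qed
  then obtain q2 u2 n2 where 2: "quadrangle G d q2 u2 n2" "A = apartment G d q2 u2 n2" by blast
  have "q = q2 \<or> q = n2" using dq 2 by (auto simp: apartment_def quadrangle_def)
  then show ?thesis using that 2 quadrangle_reflect apartment_reflect by metis
qed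

text \<open>\<open>ex_projection\<close> and \<open>projection_unique\<close> form the generalized
  quadrangle axiom. In \<open>third_point\<close> and \<open>third_line\<close> the excluded objects
  are arbitrary, so lines have at least three points and points lie on at least three lines.\<close>

locale gen_quad =
  fixes G :: "'a geometry"
  assumes line_in_points: "l \<in> lines G \<Longrightarrow> x \<in> l \<Longrightarrow> x \<in> points G"
    and line_unique: "l \<in> lines G \<Longrightarrow> m \<in> lines G \<Longrightarrow> x \<noteq> y \<Longrightarrow>
      x \<in> l \<Longrightarrow> y \<in> l \<Longrightarrow> x \<in> m \<Longrightarrow> y \<in> m \<Longrightarrow> l = m"
    and ex_projection: "l \<in> lines G \<Longrightarrow> x \<in> points G \<Longrightarrow> \<exists>y\<in>l. collinear G x y"
    and projection_unique: "l \<in> lines G \<Longrightarrow> x \<notin> l \<Longrightarrow> y \<in> l \<Longrightarrow> z \<in> l \<Longrightarrow>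
      collinear G x y \<Longrightarrow> collinear G x z \<Longrightarrow> y = z"
    and third_point: "l \<in> lines G \<Longrightarrow> \<exists>z\<in>l. z \<noteq> x \<and> z \<noteq> y"
    and third_line: "x \<in> points G \<Longrightarrow> \<exists>l\<in>lines G. x \<in> l \<and> l \<noteq> m \<and> l \<noteq> m'"
begin

abbreviation col_rel :: "'a \<Rightarrow> 'a \<Rightarrow> bool" (infix "\<sim>" 50)
  where "x \<sim> y \<equiv> collinear G x y"

lemma perp_sym: "x \<sim> y \<Longrightarrow> y \<sim> x"
  by (rule collinear_sym)

lemma line_collinear: "l \<in> lines G \<Longrightarrow> x \<in> l \<Longrightarrow> y \<in> l \<Longrightarrow> x \<sim> y"
  using line_in_points by (auto simp: collinear_def)

lemma join_eq: "l \<in> lines G \<Longrightarrow> x \<in> l \<Longrightarrow> y \<in> l \<Longrightarrow> x \<noteq> y \<Longrightarrow> join G x y = l"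
  unfolding join_def using line_unique by (intro the_equality) blast+

lemma join_line:
  assumes "x \<sim> y" "x \<noteq> y"
  shows "join G x y \<in> lines G" "x \<in> join G x y" "y \<in> join G x y"
proof -
  obtain l where "l \<in> lines G" "x \<in> l" "y \<in> l" using assms by (auto simp: collinear_def)
  then show "join G x y \<in> lines G" "x \<in> join G x y" "y \<in> join G x y"
    using join_eq assms by metis+
qed

lemma no_triangle: "l \<in> lines G \<Longrightarrow> x \<in> l \<Longrightarrow> y \<in> l \<Longrightarrow> x \<noteq> y \<Longrightarrow> z \<sim> x \<Longrightarrow> z \<sim> y \<Longrightarrow> z \<in> l"
  using projection_unique by blast

section \<open>Collineations of a generalized quadrangle\<close>

lemma collineation_collinear:
  assumes "collineation G \<phi>" "x \<sim> y"
  shows "\<phi> x \<sim> \<phi> y"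
proof -
  have p: "\<phi> permutes points G" and b: "bij_betw ((`) \<phi>) (lines G) (lines G)"
    using assms by (auto simp: collineation_def)
  have "\<phi> ` l \<in> lines G" if "l \<in> lines G" for l using b that by (auto simp: bij_betw_def)
  then show ?thesis using assms(2) permutes_in_image[OF p] unfolding collinear_def by blast
qed

lemma collineation_line: "collineation G \<phi> \<Longrightarrow> l \<in> lines G \<Longrightarrow> \<phi> ` l \<in> lines G"
  by (auto simp: collineation_def bij_betw_def)

lemma collineation_inj: "collineation G \<phi> \<Longrightarrow> inj \<phi>"
  by (auto simp: collineation_def permutes_inj)

lemma collineation_join:
  assumes "collineation G \<phi>" "x \<sim> y" "x \<noteq> y"
  shows "\<phi> ` join G x y = join G (\<phi> x) (\<phi> y)"
proof -
  have "\<phi> x \<noteq> \<phi> y" using collineation_inj[OF assms(1)] assms(3) by (auto dest: injD)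
  then show ?thesis
    using join_eq[OF collineation_line[OF assms(1)], of "join G x y" "\<phi> x" "\<phi> y"]
      join_line[OF assms(2,3)] by simp
qed

text \<open>Without triangles, a line is the set of all points collinear to two of its points, so
  collinearity alone determines the lines.\<close>

lemma collineationI:
  assumes perm: "\<phi> permutes points G"
    and iff: "\<And>x y. x \<in> points G \<Longrightarrow> y \<in> points G \<Longrightarrow> \<phi> x \<sim> \<phi> y \<longleftrightarrow> x \<sim> y"
  shows "collineation G \<phi>"
proof -
  have inj: "inj \<phi>" using perm by (rule permutes_inj)
  have image: "\<phi> ` l = m"
    if l: "l \<in> lines G" "x \<in> l" "y \<in> l" "x \<noteq> y" and m: "m \<in> lines G" "\<phi> x \<in> m" "\<phi> y \<in> m"
    for l m x y
  proof
    have xy: "x \<in> points G" "y \<in> points G" using l line_in_points by blast+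
    have ne: "\<phi> x \<noteq> \<phi> y" using inj l(4) by (auto dest: injD)
    show "\<phi> ` l \<subseteq> m"
    proof clarify
      fix z assume z: "z \<in> l"
      then have "z \<in> points G" "z \<sim> x" "z \<sim> y" using l line_in_points line_collinear by blast+
      then show "\<phi> z \<in> m" using no_triangle[OF m ne] iff xy by blast
    qed
    show "m \<subseteq> \<phi> ` l"
    proof
      fix w assume w: "w \<in> m"
      then have "w \<in> points G" using m line_in_points by blast
      then have "w \<in> \<phi> ` points G" using permutes_image[OF perm] by simp
      then obtain z where z: "z \<in> points G" "w = \<phi> z" by blast
      have "\<phi> z \<sim> \<phi> x" "\<phi> z \<sim> \<phi> y" using line_collinear m w z by blast+
      then have "z \<in> l" using no_triangle[OF l] iff xy z by blast
      then show "w \<in> \<phi> ` l" using z by blast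
    qed
  qed
  have "\<phi> ` l \<in> lines G" if l: "l \<in> lines G" for l
  proof -
    obtain x where x: "x \<in> l" using third_point[OF l] by blast
    obtain y where y: "y \<in> l" "y \<noteq> x" using third_point[OF l] by blast
    have "\<phi> x \<sim> \<phi> y" using iff line_collinear line_in_points l x y by blast
    moreover have "\<phi> x \<noteq> \<phi> y" using inj y by (auto dest: injD)
    ultimately show ?thesis using image[OF l x y(1)] join_line y by metis
  qed
  moreover have "m \<in> (`) \<phi> ` lines G" if m: "m \<in> lines G" for m
  proof -
    obtain x' where x': "x' \<in> m" using third_point[OF m] by blast
    obtain y' where y': "y' \<in> m" "y' \<noteq> x'" using third_point[OF m] by blast
    have "x' \<in> \<phi> ` points G" "y' \<in> \<phi> ` points G"
      using permutes_image[OF perm] line_in_points m x' y' by simp_all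
    then obtain x y where x: "x \<in> points G" "x' = \<phi> x" and y: "y \<in> points G" "y' = \<phi> y"
      by blast
    have "x \<sim> y" using iff[OF x(1) y(1)] line_collinear[OF m x' y'(1)] x y by simp
    moreover have "x \<noteq> y" using x y y' by blast
    ultimately have "\<phi> ` join G x y = m" "join G x y \<in> lines G"
      using image[of "join G x y" x y m] join_line[of x y] m x' y' x y by blast+
    then show ?thesis by blast
  qed
  moreover have "inj_on ((`) \<phi>) (lines G)" using inj inj_on_image[of \<phi>]
    by (meson inj_image_eq_iff inj_onI)
  ultimately show ?thesis using perm by (auto simp: collineation_def bij_betw_def)
qed

section \<open>Fixed points of collineations and rigidity of line elations\<close>

lemma collineation_disjoint_line_fixed:
  assumes \<phi>: "collineation G \<phi>" and m: "m \<in> lines G" "\<phi> ` m = m"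
    and f: "f \<in> lines G" "\<And>x. x \<in> f \<Longrightarrow> \<phi> x = x" and dis: "m \<inter> f = {}" and y: "y \<in> m"
  shows "\<phi> y = y"
proof -
  \<comment> \<open>The point \<open>y\<close> is the only one on \<open>m\<close> collinear to the
    fixed point \<open>x\<close>, a description that \<open>\<phi>\<close> preserves.\<close>
  obtain x where x: "x \<in> f" "y \<sim> x" using ex_projection[OF f(1)] line_in_points m y by blast
  have "\<phi> x \<sim> \<phi> y" using collineation_collinear[OF \<phi>] x perp_sym by metis
  moreover have "\<phi> y \<in> m" using m y by blast
  ultimately show ?thesis
    using projection_unique[OF m(1), of x] x f dis y perp_sym by (metis disjoint_iff)
qed

lemma collineation_fixed_meet:
  assumes "m \<in> lines G" "m' \<in> lines G" "m \<noteq> m'" "\<phi> ` m = m" "\<phi> ` m' = m'" "x \<in> m" "x \<in> m'"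
  shows "\<phi> x = x"
proof -
  have "\<phi> x \<in> m" "\<phi> x \<in> m'" using assms by (metis imageI)+
  then show ?thesis using line_unique[OF assms(1,2)] assms(3,6,7) by metis
qed

lemma collineation_fixed_join:
  assumes "collineation G \<phi>" "m \<in> lines G" "x \<in> m" "y \<in> m" "x \<noteq> y" "\<phi> x = x" "\<phi> y = y"
  shows "\<phi> ` m = m"
proof -
  have "x \<in> \<phi> ` m" "y \<in> \<phi> ` m" using assms by (metis imageI)+
  then show ?thesis
    using line_unique[OF collineation_line[OF assms(1,2)] assms(2,5)] assms(3,4) by blast
qed

text \<open>Fixed points spread from \<open>u\<close> to all points collinear to \<open>d\<close> or
  \<open>q\<close>. Any other point is the meet of two lines that are stabilized because each
  carries two such points.\<close>

lemma line_elation_fixing_point: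
  assumes el: "line_elation G d q \<phi>" and u: "q \<sim> u" "\<not> d \<sim> u" "\<phi> u = u" and w: "w \<in> points G"
  shows "\<phi> w = w"
proof -
  have dq: "d \<noteq> q" "d \<sim> q" and \<phi>: "collineation G \<phi>"
    and fixL: "\<And>x. x \<in> join G d q \<Longrightarrow> \<phi> x = x"
    and stab: "\<And>l. l \<in> lines G \<Longrightarrow> d \<in> l \<or> q \<in> l \<Longrightarrow> \<phi> ` l = l"
    using el by (auto simp: line_elation_def)
  define L where "L = join G d q"
  have L: "L \<in> lines G" "d \<in> L" "q \<in> L" using join_line dq by (auto simp: L_def)
  have fixL: "\<And>x. x \<in> L \<Longrightarrow> \<phi> x = x" using fixL by (simp add: L_def)
  have pts: "d \<in> points G" "q \<in> points G" "u \<in> points G" using dq u collinear_points by metis+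
  have qu: "q \<noteq> u" using dq u by blast
  define M where "M = join G q u"
  have M: "M \<in> lines G" "q \<in> M" "u \<in> M" using join_line u qu by (auto simp: M_def)
  have dM: "d \<notin> M" using line_collinear M u by blast
  obtain N where N: "N \<in> lines G" "d \<in> N" "N \<noteq> L" using third_line pts by blast
  have qN: "q \<notin> N" using line_unique N L dq by blast
  have uN: "u \<notin> N" using line_collinear N u by blast
  \<comment> \<open>The projection of the fixed point \<open>u\<close> to the stabilized line
    \<open>N\<close> is fixed.\<close>
  obtain n where n: "n \<in> N" "u \<sim> n" using ex_projection N pts by blast
  have "\<phi> n \<in> N" using stab N n by blast
  moreover have "u \<sim> \<phi> n" using collineation_collinear[OF \<phi> n(2)] u by simp
  ultimately have fn: "\<phi> n = n" using projection_unique[OF N(1) uN] n by blast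
  have np: "n \<in> points G" using line_in_points N n by blast
  have nd: "n \<noteq> d" using n u perp_sym by metis
  have nq: "\<not> q \<sim> n" using no_triangle[OF N(1) n(1) N(2) nd] qN dq perp_sym by metis
  \<comment> \<open>Thickness supplies a third line through \<open>n\<close>. It misses
    \<open>L\<close> and \<open>M\<close>, since \<open>n\<close> projects to \<open>d\<close> on
    \<open>L\<close> and to \<open>u\<close> on \<open>M\<close>. Its point \<open>s\<close> is
    fixed as the projection of \<open>n\<close> to the stabilized line \<open>T\<close>, so
    \<open>S\<close> is stabilized.\<close>
  obtain S where S: "S \<in> lines G" "n \<in> S" "S \<noteq> N" "S \<noteq> join G n u"
    using third_line[OF np, of N "join G n u"] by blast
  have qS: "q \<notin> S" using line_collinear S nq by blast
  obtain s where s: "s \<in> S" "q \<sim> s" using ex_projection S pts by blast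
  have qs: "q \<noteq> s" using s qS by blast
  define T where "T = join G q s"
  have T: "T \<in> lines G" "q \<in> T" "s \<in> T" using join_line[OF s(2) qs] by (auto simp: T_def)
  have nT: "n \<notin> T" using line_collinear T nq by blast
  have "\<phi> s \<in> T" using stab T by blast
  moreover have "n \<sim> \<phi> s"
    using collineation_collinear[OF \<phi>, of n s] line_collinear S s fn by metis
  ultimately have fs: "\<phi> s = s" using projection_unique[OF T(1) nT] T line_collinear S s by blast
  have "s \<noteq> n" using s nq by blast
  then have stS: "\<phi> ` S = S" using collineation_fixed_join[OF \<phi> S(1)] S s fn fs by blast
  have nL: "n \<notin> L" using line_collinear L nq by blast
  have dn: "n \<sim> d" using line_collinear N n by blast
  have SL: "S \<inter> L = {}"
  proof (rule ccontr)
    assume "S \<inter> L \<noteq> {}"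
    then obtain x where x: "x \<in> S" "x \<in> L" by blast
    then have "x = d" using projection_unique[OF L(1) nL] L dn line_collinear S by blast
    then show False using line_unique[OF S(1) N(1) nd] S N n x by blast
  qed
  have fixS: "\<And>x. x \<in> S \<Longrightarrow> \<phi> x = x"
    using collineation_disjoint_line_fixed[OF \<phi> S(1) stS L(1) fixL SL] by blast
  have nM: "n \<notin> M" using line_collinear M nq by blast
  have un: "u \<noteq> n" using n uN by blast
  have MS: "M \<inter> S = {}"
  proof (rule ccontr)
    assume "M \<inter> S \<noteq> {}"
    then obtain x where x: "x \<in> S" "x \<in> M" by blast
    then have "x = u" using projection_unique[OF M(1) nM] M n line_collinear S perp_sym by metis
    then show False using join_eq[OF S(1,2), of u] S x un by blast
  qed
  \<comment> \<open>Pointwise fixing passes from \<open>L\<close> to \<open>S\<close>, then to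
    \<open>M\<close>, then to the other lines through \<open>d\<close>, and from \<open>N\<close> to
    the other lines through \<open>q\<close>.\<close>
  have fixM: "\<And>x. x \<in> M \<Longrightarrow> \<phi> x = x"
    using collineation_disjoint_line_fixed[OF \<phi> M(1) _ S(1) fixS MS] stab M by blast
  have fixd: "\<phi> x = x" if "x \<in> K" "K \<in> lines G" "d \<in> K" for x K
  proof (cases "K = L")
    case True then show ?thesis using fixL that by blast
  next
    case False
    have "K \<inter> M = {}"
    proof (rule ccontr)
      assume "K \<inter> M \<noteq> {}"
      then obtain x where x: "x \<in> K" "x \<in> M" by blast
      then have "x = q" using projection_unique[OF M(1) dM] M dq line_collinear that by blast
      then show False using line_unique[OF that(2) L(1) dq(1)] x that L False by blast
    qed
    then show ?thesis
      using collineation_disjoint_line_fixed[OF \<phi> that(2) _ M(1) fixM] stab that by blast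
  qed
  have fixq: "\<phi> x = x" if "x \<in> K" "K \<in> lines G" "q \<in> K" for x K
  proof (cases "K = L")
    case True then show ?thesis using fixL that by blast
  next
    case False
    have "K \<inter> N = {}"
    proof (rule ccontr)
      assume "K \<inter> N \<noteq> {}"
      then obtain x where x: "x \<in> K" "x \<in> N" by blast
      then have "x = d"
        using projection_unique[OF N(1) qN] N dq line_collinear that perp_sym by metis
      then show False using line_unique[OF that(2) L(1) dq(1)] x that L False by blast
    qed
    then show ?thesis
      using collineation_disjoint_line_fixed[OF \<phi> that(2) _ N(1), of x] fixd N stab that by blast
  qed
  have perpd: "\<phi> x = x" if "x \<sim> d" for x
    using fixd fixL L that by (auto simp: collinear_def)
  have perpq: "\<phi> x = x" if "x \<sim> q" for x
    using fixq fixL L that by (auto simp: collinear_def)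
  show ?thesis
  proof (cases "w \<sim> d \<or> w \<sim> q")
    case True then show ?thesis using perpd perpq by blast
  next
    case False
    have wL: "w \<notin> L" using line_collinear L False by blast
    obtain r where r: "r \<in> L" "w \<sim> r" using ex_projection[OF L(1) w] by blast
    obtain l1 where l1: "l1 \<in> lines G" "w \<in> l1" "l1 \<noteq> join G w r"
      using third_line[OF w, of "join G w r"] by blast
    obtain l2 where l2: "l2 \<in> lines G" "w \<in> l2" "l2 \<noteq> join G w r" "l2 \<noteq> l1"
      using third_line[OF w, of "join G w r" l1] by blast
    \<comment> \<open>Such a line misses \<open>L\<close>. Its points \<open>e\<close> and
      \<open>f\<close> collinear to \<open>d\<close> and \<open>q\<close> are fixed, and they are
      distinct because a point collinear to both \<open>d\<close> and \<open>q\<close> lies on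
      \<open>L\<close>.\<close>
    have "\<phi> ` l = l" if l: "l \<in> lines G" "w \<in> l" "l \<noteq> join G w r" for l
    proof -
      have lL: "x \<notin> L" if x: "x \<in> l" for x
      proof
        assume "x \<in> L"
        then have "x = r" using projection_unique[OF L(1) wL] r line_collinear l x by blast
        then show False using join_eq[OF l(1,2) x] wL r l by blast
      qed
      obtain e where e: "e \<in> l" "d \<sim> e" using ex_projection[OF l(1)] pts by blast
      obtain f where f: "f \<in> l" "q \<sim> f" using ex_projection[OF l(1)] pts by blast
      have "e \<noteq> f"
        using no_triangle[OF L dq(1)] lL e f perp_sym by metis
      then show ?thesis
        using collineation_fixed_join[OF \<phi> l(1)] e f perpd perpq perp_sym by metis
    qed
    then show ?thesis using collineation_fixed_meet[of l1 l2] l1 l2 by metis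
  qed
qed

section \<open>Uniqueness of line elations and the Moufang condition\<close>

lemma line_elation_inv_comp:
  assumes "line_elation G d q \<theta>" "line_elation G d q \<psi>"
  shows "line_elation G d q (inv \<psi> \<circ> \<theta>)"
proof -
  have t: "\<theta> permutes points G" "bij_betw ((`) \<theta>) (lines G) (lines G)"
    and s: "\<psi> permutes points G" "bij_betw ((`) \<psi>) (lines G) (lines G)"
    using assms by (auto simp: line_elation_def collineation_def)
  have inv: "inv \<psi> ` \<psi> ` l = l" "inv \<psi> (\<psi> x) = x" for l x
    using permutes_inj[OF s(1)] by (auto simp: image_comp)
  have "(`) (inv \<psi>) ` (`) \<psi> ` lines G = lines G" by (simp add: image_image inv)
  then have "(`) (inv \<psi>) ` lines G = lines G" using s by (simp add: bij_betw_def)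
  moreover have "inj ((`) (inv \<psi>))"
    using permutes_inj[OF permutes_inv[OF s(1)]] by (simp add: inj_image_eq_iff inj_def)
  ultimately have "bij_betw ((`) (inv \<psi>)) (lines G) (lines G)"
    by (auto simp: bij_betw_def intro: inj_on_subset)
  then have "bij_betw ((`) (inv \<psi>) \<circ> (`) \<theta>) (lines G) (lines G)" using t by (metis bij_betw_trans)
  moreover have "(`) (inv \<psi>) \<circ> (`) \<theta> = (`) (inv \<psi> \<circ> \<theta>)" by (auto simp: fun_eq_iff)
  moreover have "inv \<psi> \<circ> \<theta> permutes points G"
    using permutes_compose[OF t(1) permutes_inv[OF s(1)]] .
  ultimately have "collineation G (inv \<psi> \<circ> \<theta>)" by (simp add: collineation_def)
  moreover have "inv \<psi> x = x" if "\<psi> x = x" for x using inv(2)[of x] that by simp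
  moreover have "inv \<psi> ` l = l" if "\<psi> ` l = l" for l using inv(1)[of l] that by simp
  ultimately show ?thesis using assms unfolding line_elation_def image_comp[symmetric] by simp
qed

text \<open>Rigidity applied to \<open>inv \<psi> \<circ> \<theta>\<close>, which fixes
  \<open>u\<close>.\<close>

lemma line_elation_eqI:
  assumes "line_elation G d q \<theta>" "line_elation G d q \<psi>"
    and "q \<sim> u" "\<not> d \<sim> u" "\<theta> u = \<psi> u" and w: "w \<in> points G"
  shows "\<theta> w = \<psi> w"
proof -
  have p: "\<psi> permutes points G" using assms by (auto simp: line_elation_def collineation_def)
  have "(inv \<psi> \<circ> \<theta>) u = u" using assms permutes_inj[OF p] by simp
  then have "(inv \<psi> \<circ> \<theta>) w = w"
    using line_elation_fixing_point line_elation_inv_comp assms by blast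
  then show ?thesis using permutes_inverses[OF p] by (metis comp_apply)
qed

text \<open>An apartment containing the root is determined by its point other than \<open>q\<close>
  on \<open>qu\<close>: the fourth corner is the projection of that point to \<open>dn\<close>. So
  transitivity on these points suffices.\<close>

lemma moufang_second_kind_rootI:
  assumes quad: "quadrangle G d q u n"
    and trans: "\<And>u1 u2. u1 \<in> join G q u \<Longrightarrow> u1 \<noteq> q \<Longrightarrow> u2 \<in> join G q u \<Longrightarrow> u2 \<noteq> q \<Longrightarrow>
      \<exists>\<theta>. line_elation G d q \<theta> \<and> \<theta> u1 = u2"
  shows "moufang_second_kind_root G d q u n"
proof -
  have q: "d \<sim> q" "q \<sim> u" "n \<sim> d" "\<not> d \<sim> u" "\<not> q \<sim> n"
    and ne: "d \<noteq> q" "q \<noteq> u" "n \<noteq> d"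
    using quad perp_sym by (auto simp: quadrangle_def)
  have QU: "join G q u \<in> lines G" "q \<in> join G q u" "u \<in> join G q u" using join_line q ne by blast+
  have DN: "join G d n \<in> lines G" "d \<in> join G d n" "n \<in> join G d n"
    using join_line[of n d] q ne by (simp_all add: join_commute)
  \<comment> \<open>Set membership alone does not tell which sides of \<open>A\<close> are
    \<open>dn\<close> and \<open>qu\<close>. Incidence with \<open>d\<close> and \<open>q\<close>
    decides: \<open>dn\<close> contains only \<open>d\<close>, \<open>qu\<close> only
    \<open>q\<close>, and \<open>u'n'\<close> neither.\<close>
  have labels: "\<exists>u' n'. quadrangle G d q u' n' \<and> A = apartment G d q u' n' \<and>
      u' \<in> join G q u \<and> n' \<in> join G d n"
    if A: "A \<in> apartments G" "second_kind_root G d q u n \<subseteq> A" for A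
  proof -
    have sub: "Inl d \<in> A" "Inl q \<in> A" "Inr (join G d n) \<in> A" "Inr (join G q u) \<in> A"
      using A(2) by (auto simp: second_kind_root_def)
    obtain u' n' where 1: "quadrangle G d q u' n'" "A = apartment G d q u' n'"
      using apartment_at_flag A(1) sub(1,2) ne(1) q(1) by metis
    have c: "q \<sim> u'" "u' \<sim> n'" "n' \<sim> d" "\<not> d \<sim> u'" "\<not> q \<sim> n'"
      and ne': "q \<noteq> u'" "u' \<noteq> n'" "n' \<noteq> d"
      using 1(1) q perp_sym by (auto simp: quadrangle_def)
    note J = join_line[OF q(1) ne(1)] join_line[OF c(1) ne'(1)] join_line[OF c(2) ne'(2)]
      join_line[OF c(3) ne'(3)]
    have "join G d n \<in> {join G d q, join G q u', join G u' n', join G n' d}"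
      using sub(3) 1(2) by (auto simp: apartment_def)
    moreover have "q \<notin> join G d n" using line_collinear DN q by blast
    moreover have "d \<notin> join G u' n'" using line_collinear J c by blast
    ultimately have "join G d n = join G n' d" using J DN by auto
    moreover have "join G q u \<in> {join G d q, join G q u', join G u' n', join G n' d}"
      using sub(4) 1(2) by (auto simp: apartment_def)
    moreover have "d \<notin> join G q u" using line_collinear QU q by blast
    moreover have "q \<notin> join G u' n'" using line_collinear J c by blast
    ultimately have "join G d n = join G n' d" "join G q u = join G q u'" using J QU by auto
    then show ?thesis using 1 J by auto
  qed
  have "\<exists>\<theta>. line_elation G d q \<theta> \<and> map_sum \<theta> ((`) \<theta>) ` A = B"
    if A: "A \<in> apartments G" "second_kind_root G d q u n \<subseteq> A"
      and B: "B \<in> apartments G" "second_kind_root G d q u n \<subseteq> B" for A B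
  proof -
    obtain u1 n1 where 1: "quadrangle G d q u1 n1" "A = apartment G d q u1 n1"
      "u1 \<in> join G q u" "n1 \<in> join G d n" using labels A by blast
    obtain u2 n2 where 2: "quadrangle G d q u2 n2" "B = apartment G d q u2 n2"
      "u2 \<in> join G q u" "n2 \<in> join G d n" using labels B by blast
    have c1: "q \<sim> u1" "u1 \<sim> n1" "n1 \<sim> d" "q \<noteq> u1" "u1 \<noteq> n1" "n1 \<noteq> d"
      using 1(1) q perp_sym by (auto simp: quadrangle_def)
    have c2: "q \<sim> u2" "u2 \<sim> n2" "\<not> d \<sim> u2" "q \<noteq> u2"
      using 2(1) q perp_sym by (auto simp: quadrangle_def)
    obtain \<theta> where \<theta>: "line_elation G d q \<theta>" "\<theta> u1 = u2" using trans 1 2 c1 c2 by metis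
    have col: "collineation G \<theta>" and fd: "\<theta> d = d" and fq: "\<theta> q = q"
      and st: "\<And>l. l \<in> lines G \<Longrightarrow> d \<in> l \<Longrightarrow> \<theta> ` l = l"
      using \<theta> join_line[OF q(1) ne(1)] by (auto simp: line_elation_def)
    have "\<theta> n1 \<in> join G d n" using st[OF DN(1,2)] 1(4) by blast
    moreover have "u2 \<sim> \<theta> n1" using collineation_collinear[OF col c1(2)] \<theta>(2) by simp
    moreover have "u2 \<notin> join G d n" using line_collinear DN c2 by blast
    ultimately have fn: "\<theta> n1 = n2" using projection_unique[OF DN(1)] 2(4) c2(2) by blast
    have "map_sum \<theta> ((`) \<theta>) ` apartment G d q u1 n1 = apartment G d q u2 n2"
      unfolding apartment_def
      by (simp add: collineation_join[OF col] q(1) ne(1) c1 fd fq fn \<theta>(2))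
    then show ?thesis using \<theta> 1 2 by blast
  qed
  then show ?thesis unfolding moufang_second_kind_root_def by blast
qed

end

section \<open>Opposite points of a thick polar space of rank three\<close>

text \<open>The point-level form of \<open>proj G c e\<close>: the line \<open>cx\<close> is sent to
  the join of \<open>e\<close> with this point.\<close>

definition foot :: "'a geometry \<Rightarrow> 'a \<Rightarrow> 'a \<Rightarrow> 'a \<Rightarrow> 'a" where
  "foot G c e x = (THE u. u \<in> join G c x \<and> collinear G u e)"

context nondeg_polar
begin

lemma opposite_sym: "opposite \<Delta> x y \<Longrightarrow> opposite \<Delta> y x"
  using perp_sym by (auto simp: opposite_def)

lemma opposite_not_collinear: "opposite \<Delta> x y \<Longrightarrow> \<not> x \<sim> y \<and> \<not> y \<sim> x"
  using perp_sym by (auto simp: opposite_def)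

section \<open>Projections between residues, computed on points\<close>

lemma opposite_on_line:
  assumes "opposite \<Delta> e c" "c \<sim> x" "e \<sim> x" "y \<in> join \<Delta> c x" "y \<noteq> x"
  shows "opposite \<Delta> e y"
proof -
  have cx: "c \<noteq> x" using assms by (auto simp: opposite_def)
  note J = join_line[OF assms(2) cx]
  have "\<not> e \<sim> y" using perp_line[OF J(1) assms(4) J(3) assms(5) _ assms(3) J(2)] assms(1)
    by (auto simp: opposite_def)
  then show ?thesis using line_in_points[OF J(1) assms(4)] assms(1) by (simp add: opposite_def)
qed

lemma foot_unique:
  assumes "opposite \<Delta> c e" "c \<sim> x" "c \<noteq> x" "u \<in> join \<Delta> c x" "u \<sim> e" "v \<in> join \<Delta> c x" "v \<sim> e"
  shows "u = v"
  using perp_line_unique[OF join_line(1)[OF assms(2,3)] assms(4,6) _ _ join_line(2)[OF assms(2,3)], of e]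
    assms perp_sym opposite_not_collinear by blast

lemma foot_eqI:
  assumes "opposite \<Delta> c e" "c \<sim> x" "c \<noteq> x" "u \<in> join \<Delta> c x" "u \<sim> e"
  shows "foot \<Delta> c e x = u"
  unfolding foot_def using foot_unique[OF assms(1-3)] assms(4,5) by (intro the_equality) blast+

lemma foot:
  assumes "opposite \<Delta> c e" "c \<sim> x" "c \<noteq> x"
  shows "foot \<Delta> c e x \<in> join \<Delta> c x" "foot \<Delta> c e x \<sim> e" "c \<sim> foot \<Delta> c e x" "c \<noteq> foot \<Delta> c e x"
proof -
  note J = join_line[OF assms(2,3)]
  obtain u where u: "u \<in> join \<Delta> c x" "e \<sim> u"
    using perp_meets[OF J(1)] assms(1) by (auto simp: opposite_def)
  then have f: "foot \<Delta> c e x = u" using foot_eqI assms perp_sym by blast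
  show "foot \<Delta> c e x \<in> join \<Delta> c x" using f u by simp
  show "foot \<Delta> c e x \<sim> e" using f u perp_sym by simp
  show "c \<sim> foot \<Delta> c e x" using f line_collinear[OF J(1,2) u(1)] by simp
  show "c \<noteq> foot \<Delta> c e x" using f u opposite_not_collinear[OF assms(1)] by auto
qed

lemma foot_id: "opposite \<Delta> c e \<Longrightarrow> c \<sim> x \<Longrightarrow> c \<noteq> x \<Longrightarrow> x \<sim> e \<Longrightarrow> foot \<Delta> c e x = x"
  using foot_eqI[of c e x x] join_line(3) by blast

lemma join_foot:
  assumes "opposite \<Delta> c e" "c \<sim> x" "c \<noteq> x"
  shows "join \<Delta> c (foot \<Delta> c e x) = join \<Delta> c x"
  using join_eq[OF join_line(1,2)[OF assms(2,3)] foot(1,4)[OF assms]] .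

text \<open>The point \<open>y\<close> is collinear to all of \<open>cx\<close>, hence to the foot
  there; this foot is then collinear to all of \<open>cy\<close>.\<close>

lemma foot_collinear:
  assumes c: "opposite \<Delta> c e" and x: "c \<sim> x" "c \<noteq> x" and y: "c \<sim> y" "c \<noteq> y" and xy: "x \<sim> y"
  shows "foot \<Delta> c e x \<sim> foot \<Delta> c e y"
proof -
  have "y \<sim> foot \<Delta> c e x" using perp_join[OF x _ _ foot(1)[OF c x]] y xy perp_sym by blast
  then show ?thesis
    using perp_join[OF y _ _ foot(1)[OF c y]] foot(3)[OF c x] perp_sym by blast
qed

lemma proj_join:
  assumes "opposite \<Delta> c e" "c \<sim> x" "c \<noteq> x"
  shows "proj \<Delta> c e (join \<Delta> c x) = join \<Delta> e (foot \<Delta> c e x)"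
  using join_line[OF assms(2,3)] by (simp add: proj_def residue_def foot_def)

text \<open>For opposite \<open>c\<close> and \<open>e\<close>, each line through \<open>c\<close>
  or through \<open>e\<close> has exactly one point in this set, which therefore represents the
  points of both residues.\<close>

definition trace :: "'a \<Rightarrow> 'a \<Rightarrow> 'a set" where
  "trace c e = {x. c \<sim> x \<and> e \<sim> x}"

lemma trace_commute: "trace c e = trace e c"
  by (auto simp: trace_def)

lemma trace_ne: "opposite \<Delta> c e \<Longrightarrow> x \<in> trace c e \<Longrightarrow> c \<noteq> x \<and> e \<noteq> x"
  using opposite_not_collinear by (auto simp: trace_def)

text \<open>The foot stays on the line \<open>cx\<close>, where \<open>x\<close> is the only point
  collinear to \<open>a\<close>; hence \<open>foot \<Delta> c a\<close> undoes
  \<open>foot \<Delta> c e\<close>.\<close>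

lemma foot_trace:
  assumes a: "opposite \<Delta> a c" and e: "opposite \<Delta> c e" and x: "x \<in> trace a c"
  shows "foot \<Delta> c e x \<in> trace c e" "foot \<Delta> c a (foot \<Delta> c e x) = x"
proof -
  have cx: "c \<sim> x" "c \<noteq> x" using x trace_ne[OF a x] by (auto simp: trace_def)
  note F = foot[OF e cx]
  show "foot \<Delta> c e x \<in> trace c e" using F perp_sym by (auto simp: trace_def)
  show "foot \<Delta> c a (foot \<Delta> c e x) = x"
  proof (rule foot_eqI[OF opposite_sym[OF a] F(3,4)])
    show "x \<in> join \<Delta> c (foot \<Delta> c e x)" using join_foot[OF e cx] join_line[OF cx] by simp
    show "x \<sim> a" using x perp_sym by (auto simp: trace_def)
  qed
qed

lemma foot_bij_betw:
  assumes a: "opposite \<Delta> a c" and e: "opposite \<Delta> c e"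
  shows "bij_betw (foot \<Delta> c e) (trace a c) (trace c e)"
proof (rule bij_betw_byWitness[where f' = "foot \<Delta> c a"])
  show "\<forall>x\<in>trace a c. foot \<Delta> c a (foot \<Delta> c e x) = x" using foot_trace[OF a e] by blast
  note E = foot_trace[OF opposite_sym[OF e] opposite_sym[OF a]]
  show "\<forall>x\<in>trace c e. foot \<Delta> c e (foot \<Delta> c a x) = x" using E trace_commute by blast
  show "foot \<Delta> c e ` trace a c \<subseteq> trace c e" using foot_trace[OF a e] by blast
  show "foot \<Delta> c a ` trace c e \<subseteq> trace a c" using E trace_commute by blast
qed

lemma foot_trace_collinear_iff:
  assumes a: "opposite \<Delta> a c" and e: "opposite \<Delta> c e" and x: "x \<in> trace a c" and y: "y \<in> trace a c"
  shows "foot \<Delta> c e x \<sim> foot \<Delta> c e y \<longleftrightarrow> x \<sim> y"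
proof
  have cx: "c \<sim> x" "c \<noteq> x" using x trace_ne[OF a x] by (auto simp: trace_def)
  have cy: "c \<sim> y" "c \<noteq> y" using y trace_ne[OF a y] by (auto simp: trace_def)
  show "foot \<Delta> c e x \<sim> foot \<Delta> c e y" if "x \<sim> y" using foot_collinear[OF e cx cy that] .
  show "x \<sim> y" if "foot \<Delta> c e x \<sim> foot \<Delta> c e y"
    using foot_collinear[OF opposite_sym[OF a] foot(3,4)[OF e cx] foot(3,4)[OF e cy] that]
      foot_trace(2)[OF a e x] foot_trace(2)[OF a e y] by simp
qed

section \<open>The geometry induced on a trace\<close>

abbreviation \<Gamma> :: "'a \<Rightarrow> 'a \<Rightarrow> 'a geometry" where "\<Gamma> \<equiv> perp_quadrangle \<Delta>"

lemma points_\<Gamma>: "points (\<Gamma> p b) = trace p b"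
  by (auto simp: perp_quadrangle_def induced_def perp_def trace_def)

lemma lines_\<Gamma>: "l \<in> lines (\<Gamma> p b) \<longleftrightarrow> l \<in> lines \<Delta> \<and> l \<subseteq> trace p b"
  by (auto simp: perp_quadrangle_def induced_def perp_def trace_def)

lemma line_\<Gamma>I:
  "l \<in> lines \<Delta> \<Longrightarrow> x \<in> l \<Longrightarrow> y \<in> l \<Longrightarrow> x \<noteq> y \<Longrightarrow> x \<in> trace p b \<Longrightarrow> y \<in> trace p b \<Longrightarrow> l \<in> lines (\<Gamma> p b)"
  using perp_line[of l x y] by (auto simp: lines_\<Gamma> trace_def)

lemma collinear_\<Gamma>: "collinear (\<Gamma> p b) x y \<longleftrightarrow> x \<in> trace p b \<and> y \<in> trace p b \<and> x \<sim> y"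
proof
  assume "collinear (\<Gamma> p b) x y"
  then show "x \<in> trace p b \<and> y \<in> trace p b \<and> x \<sim> y"
    unfolding collinear_def points_\<Gamma> using lines_\<Gamma>
    by (auto simp: trace_def dest: collinear_points)
next
  assume r: "x \<in> trace p b \<and> y \<in> trace p b \<and> x \<sim> y"
  show "collinear (\<Gamma> p b) x y"
  proof (cases "x = y")
    case True then show ?thesis using r by (simp add: collinear_def points_\<Gamma>)
  next
    case False
    then have "join \<Delta> x y \<in> lines (\<Gamma> p b)"
      using line_\<Gamma>I[of "join \<Delta> x y" x y] join_line r by blast
    then show ?thesis using r join_line[of x y] False unfolding collinear_def points_\<Gamma> by blast
  qed
qed

lemma join_\<Gamma>:
  assumes xy: "x \<in> trace p b" "y \<in> trace p b" "x \<sim> y" "x \<noteq> y"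
  shows "join (\<Gamma> p b) x y = join \<Delta> x y"
  unfolding join_def[of "\<Gamma> p b"]
proof (rule the_equality)
  note J = join_line[OF xy(3,4)]
  show "join \<Delta> x y \<in> lines (\<Gamma> p b) \<and> x \<in> join \<Delta> x y \<and> y \<in> join \<Delta> x y"
    using line_\<Gamma>I[OF J xy(4,1,2)] J by blast
  show "l = join \<Delta> x y" if "l \<in> lines (\<Gamma> p b) \<and> x \<in> l \<and> y \<in> l" for l
    using join_eq[of l x y] xy(4) that lines_\<Gamma> by blast
qed

end

section \<open>Planes, and the quadrangle axioms for the trace\<close>

locale thick_polar_three = nondeg_polar +
  assumes rank: "rank_three \<Delta>" and thick: "thick \<Delta>"
begin

text \<open>Zorn's lemma gives a maximal set of pairwise collinear points containing
  \<open>C\<close>. It is a subspace: a point on a line through two of its points is collinear to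
  all of it, hence belongs to it by maximality. Then \<open>rank_three\<close> applies.\<close>

lemma clique_in_plane:
  assumes C: "C \<subseteq> points \<Delta>" "\<And>x y. x \<in> C \<Longrightarrow> y \<in> C \<Longrightarrow> x \<sim> y"
  obtains S where "C \<subseteq> S" "projective_plane (induced \<Delta> S)"
proof -
  define \<A> where "\<A> = {K. C \<subseteq> K \<and> K \<subseteq> points \<Delta> \<and> (\<forall>x\<in>K. \<forall>y\<in>K. x \<sim> y)}"
  have "\<exists>M\<in>\<A>. \<forall>X\<in>\<A>. M \<subseteq> X \<longrightarrow> X = M"
  proof (rule subset_Zorn_nonempty)
    show "\<A> \<noteq> {}" using C by (auto simp: \<A>_def)
    fix K assume K: "K \<noteq> {}" "subset.chain \<A> K"
    have sub: "k \<in> \<A>" if "k \<in> K" for k using K that by (auto simp: subset.chain_def)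
    have "x \<sim> y" if x: "x \<in> k" "k \<in> K" and y: "y \<in> k'" "k' \<in> K" for x y k k'
    proof -
      have "k \<subseteq> k' \<or> k' \<subseteq> k" using K x y by (auto simp: subset.chain_def)
      then show ?thesis using sub[OF x(2)] sub[OF y(2)] x y unfolding \<A>_def by blast
    qed
    then have "\<forall>x\<in>\<Union>K. \<forall>y\<in>\<Union>K. x \<sim> y" by blast
    moreover have "C \<subseteq> k \<and> k \<subseteq> points \<Delta>" if "k \<in> K" for k using sub[OF that] by (simp add: \<A>_def)
    then have "C \<subseteq> \<Union>K" "\<Union>K \<subseteq> points \<Delta>" using K(1) by blast+
    ultimately show "\<Union>K \<in> \<A>" by (simp add: \<A>_def)
  qed
  then obtain M where M: "M \<in> \<A>" and max: "\<And>X. X \<in> \<A> \<Longrightarrow> M \<subseteq> X \<Longrightarrow> X = M" by blast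
  have Mcol: "x \<sim> y" if "x \<in> M" "y \<in> M" for x y using M that by (auto simp: \<A>_def)
  have abs: "z \<in> M" if z: "z \<in> points \<Delta>" "\<And>x. x \<in> M \<Longrightarrow> x \<sim> z" for z
  proof -
    have "z \<sim> z" using z by (simp add: collinear_def)
    then have "insert z M \<in> \<A>" using M z perp_sym unfolding \<A>_def by blast
    then show ?thesis using max by blast
  qed
  have "l \<subseteq> M" if l: "l \<in> lines \<Delta>" "x \<in> l \<inter> M" "y \<in> l \<inter> M" "x \<noteq> y" for l x y
  proof
    fix z assume z: "z \<in> l"
    show "z \<in> M"
    proof (rule abs)
      show "z \<in> points \<Delta>" using line_in_points[OF l(1) z] .
      show "a \<sim> z" if "a \<in> M" for a
        using perp_line[OF l(1) _ _ l(4) _ _ z] l(2,3) Mcol that by blast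
    qed
  qed
  then have "singular_subspace \<Delta> M"
    using M Mcol unfolding singular_subspace_def is_subspace_def \<A>_def by blast
  moreover have "S = M" if "singular_subspace \<Delta> S" "M \<subseteq> S" for S
  proof -
    have "S \<in> \<A>" using that M unfolding singular_subspace_def is_subspace_def \<A>_def by blast
    then show ?thesis using max that by blast
  qed
  ultimately have "projective_plane (induced \<Delta> M)"
    using rank unfolding rank_three_def maximal_singular_subspace_def by blast
  then show ?thesis using that M by (auto simp: \<A>_def)
qed

lemma projective_plane_lines_meet:
  assumes "projective_plane (induced \<Delta> S)" "l \<in> lines \<Delta>" "m \<in> lines \<Delta>" "l \<subseteq> S" "m \<subseteq> S" "l \<noteq> m"
  shows "\<exists>x. x \<in> l \<and> x \<in> m"
proof -
  have "\<forall>l\<in>lines (induced \<Delta> S). \<forall>m\<in>lines (induced \<Delta> S). l \<noteq> m \<longrightarrow> (\<exists>!x. x \<in> l \<and> x \<in> m)"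
    using assms(1) by (simp add: projective_plane_def)
  moreover have "l \<in> lines (induced \<Delta> S)" "m \<in> lines (induced \<Delta> S)"
    using assms by (simp_all add: induced_def)
  ultimately show ?thesis using assms(6) by blast
qed

text \<open>The two lines together form a clique, so rank three places them in one projective
  plane.\<close>

lemma collinear_lines_meet:
  assumes l: "l \<in> lines \<Delta>" and m: "m \<in> lines \<Delta>" and lm: "\<And>x y. x \<in> l \<Longrightarrow> y \<in> m \<Longrightarrow> x \<sim> y"
  shows "\<exists>x. x \<in> l \<and> x \<in> m"
proof (cases "l = m")
  case True then show ?thesis using third_point l by blast
next
  case False
  have "l \<union> m \<subseteq> points \<Delta>" using line_in_points l m by blast
  moreover have "x \<sim> y" if "x \<in> l \<union> m" "y \<in> l \<union> m" for x y
    using that lm perp_sym line_collinear[OF l] line_collinear[OF m] by blast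
  ultimately obtain S where "l \<union> m \<subseteq> S" "projective_plane (induced \<Delta> S)"
    using clique_in_plane by metis
  then show ?thesis using projective_plane_lines_meet l m False by blast
qed

text \<open>A plane through \<open>p\<close> is the cone over the line it cuts out of the trace.
  Since the cone recovers \<open>S\<close> from \<open>l\<close>, different planes through
  \<open>px\<close> give different lines of the quadrangle.\<close>

lemma plane_trace:
  assumes S: "is_plane \<Delta> S" and x: "p \<in> S" "x \<in> S" "x \<in> trace p b" and pb: "opposite \<Delta> p b"
  obtains l where "l \<in> lines (\<Gamma> p b)" "x \<in> l" "S = (\<Union>r\<in>l. join \<Delta> p r)"
proof -
  have pp: "projective_plane (induced \<Delta> S)" and col: "\<And>x y. x \<in> S \<Longrightarrow> y \<in> S \<Longrightarrow> x \<sim> y"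
    and sub: "\<And>l x y. l \<in> lines \<Delta> \<Longrightarrow> x \<in> l \<Longrightarrow> y \<in> l \<Longrightarrow> x \<in> S \<Longrightarrow> y \<in> S \<Longrightarrow> x \<noteq> y \<Longrightarrow> l \<subseteq> S"
    using S unfolding is_plane_def singular_subspace_def is_subspace_def by blast+
  have px: "p \<noteq> x" using trace_ne[OF pb x(3)] by simp
  note J = join_line[OF col[OF x(1,2)] px]
  have JS: "join \<Delta> p x \<in> lines (induced \<Delta> S)" using J sub[OF J x(1,2) px] by (simp add: induced_def)
  \<comment> \<open>A plane has points off \<open>px\<close>; for such a \<open>y\<close>, the point
    of \<open>py\<close> collinear to \<open>b\<close> is a second point of the trace in
    \<open>S\<close>.\<close>
  obtain y where y: "y \<in> S" "y \<notin> join \<Delta> p x"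
  proof -
    obtain w1 w2 w3 where "{w1, w2, w3} \<subseteq> S"
      "\<And>l. l \<in> lines (induced \<Delta> S) \<Longrightarrow> \<not> {w1, w2, w3} \<subseteq> l"
      using pp unfolding projective_plane_def by (auto simp: induced_def)
    then show ?thesis using that JS by blast
  qed
  have py: "p \<noteq> y" using y J by blast
  note K = join_line[OF col[OF x(1) y(1)] py]
  obtain z where z: "z \<in> join \<Delta> p y" "b \<sim> z"
    using perp_meets[OF K(1)] pb by (auto simp: opposite_def)
  have zS: "z \<in> S" using sub[OF K x(1) y(1) py] z by blast
  have "x \<notin> join \<Delta> p y" using join_eq[OF K(1,2) _ px] K(3) y(2) by blast
  then have xz: "x \<noteq> z" using z by blast
  note L = join_line[OF col[OF x(2) zS] xz]
  have zt: "z \<in> trace p b" using z col[OF x(1) zS] by (simp add: trace_def)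
  have LG: "join \<Delta> x z \<in> lines (\<Gamma> p b)" using line_\<Gamma>I[OF L xz x(3) zt] .
  have LS: "join \<Delta> x z \<subseteq> S" using sub[OF L x(2) zS xz] .
  have pL: "p \<noteq> r" if "r \<in> join \<Delta> x z" for r using LG that trace_ne[OF pb] lines_\<Gamma> by blast
  have "S = (\<Union>r\<in>join \<Delta> x z. join \<Delta> p r)"
  proof
    show "(\<Union>r\<in>join \<Delta> x z. join \<Delta> p r) \<subseteq> S"
    proof clarify
      fix r s assume r: "r \<in> join \<Delta> x z" and s: "s \<in> join \<Delta> p r"
      have rS: "r \<in> S" using LS r by blast
      show "s \<in> S" using sub[OF join_line[OF col[OF x(1) rS] pL[OF r]] x(1) rS pL[OF r]] s by blast
    qed
    show "S \<subseteq> (\<Union>r\<in>join \<Delta> x z. join \<Delta> p r)"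
    proof
      fix s assume s: "s \<in> S"
      show "s \<in> (\<Union>r\<in>join \<Delta> x z. join \<Delta> p r)"
      proof (cases "s = p")
        case True then show ?thesis using J L by blast
      next
        case False
        then have ps: "p \<noteq> s" by blast
        note M = join_line[OF col[OF x(1) s] ps]
        \<comment> \<open>The lines \<open>ps\<close> and \<open>xz\<close> of the plane are
          distinct and so meet, which puts \<open>s\<close> on a line from \<open>p\<close> to a
          point of \<open>xz\<close>.\<close>
        have "join \<Delta> p s \<noteq> join \<Delta> x z" using pL M(2) by blast
        then obtain r where r: "r \<in> join \<Delta> p s" "r \<in> join \<Delta> x z"
          using projective_plane_lines_meet[OF pp M(1) L(1) sub[OF M x(1) s ps] LS] by blast
        then have "join \<Delta> p r = join \<Delta> p s" using join_eq[OF M(1,2)] pL by blast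
        then show ?thesis using r M by blast
      qed
    qed
  qed
  then show ?thesis using that LG L by blast
qed

lemma gen_quad_\<Gamma>:
  assumes pb: "opposite \<Delta> p b"
  shows "gen_quad (\<Gamma> p b)"
proof
  show "x \<in> points (\<Gamma> p b)" if "l \<in> lines (\<Gamma> p b)" "x \<in> l" for l x
    using that points_\<Gamma> lines_\<Gamma> by blast
  show "l = m" if "l \<in> lines (\<Gamma> p b)" "m \<in> lines (\<Gamma> p b)" "x \<noteq> y"
    "x \<in> l" "y \<in> l" "x \<in> m" "y \<in> m" for l m x y
    using line_unique that lines_\<Gamma> by blast
  show "\<exists>y\<in>l. collinear (\<Gamma> p b) x y" if "l \<in> lines (\<Gamma> p b)" "x \<in> points (\<Gamma> p b)" for l x
  proof -
    have l: "l \<in> lines \<Delta>" "l \<subseteq> trace p b" and x: "x \<in> trace p b"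
      using that lines_\<Gamma> points_\<Gamma> by blast+
    have "x \<in> points \<Delta>" using x by (auto simp: trace_def dest: collinear_points)
    then obtain y where "y \<in> l" "x \<sim> y" using perp_meets l by blast
    then show ?thesis using collinear_\<Gamma> l x by blast
  qed
  show "\<exists>z\<in>l. z \<noteq> x \<and> z \<noteq> y" if "l \<in> lines (\<Gamma> p b)" for l x y
    using third_point that lines_\<Gamma> by blast
  show "y = z" if "l \<in> lines (\<Gamma> p b)" "x \<notin> l" "y \<in> l" "z \<in> l"
    "collinear (\<Gamma> p b) x y" "collinear (\<Gamma> p b) x z" for l x y z
  proof (rule ccontr)
    \<comment> \<open>With two neighbours of \<open>x\<close> on \<open>l\<close>, all of
      \<open>l\<close> would be collinear to all of \<open>px\<close>, so the lines would meet in
      some \<open>r\<close> other than \<open>x\<close>. Then \<open>b\<close>, collinear to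
      \<open>r\<close> and \<open>x\<close>, would be collinear to \<open>p\<close>.\<close>
    assume yz: "y \<noteq> z"
    have l: "l \<in> lines \<Delta>" "l \<subseteq> trace p b" and x: "x \<in> trace p b"
      and xyz: "x \<sim> y" "x \<sim> z" using that lines_\<Gamma> collinear_\<Gamma> by blast+
    have px: "p \<sim> x" "p \<noteq> x" using x trace_ne[OF pb x] by (simp_all add: trace_def)
    note J = join_line[OF px]
    have "w \<sim> v" if "w \<in> l" "v \<in> join \<Delta> p x" for v w
    proof (rule perp_join[OF px _ _ that(2)])
      show "w \<sim> p" using l that perp_sym by (auto simp: trace_def)
      show "w \<sim> x"
        using perp_line[OF l(1) \<open>y \<in> l\<close> \<open>z \<in> l\<close> yz xyz that(1)] perp_sym by blast
    qed
    then obtain r where r: "r \<in> l" "r \<in> join \<Delta> p x" using collinear_lines_meet l J by blast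
    have "r \<noteq> x" using r \<open>x \<notin> l\<close> by blast
    moreover have "b \<sim> r" "b \<sim> x" using l r x by (auto simp: trace_def)
    ultimately have "b \<sim> p" using perp_line[OF J(1) r(2) J(3) _ _ _ J(2)] by blast
    then show False using opposite_not_collinear pb by blast
  qed
  show "\<exists>l\<in>lines (\<Gamma> p b). x \<in> l \<and> l \<noteq> m \<and> l \<noteq> m'" if "x \<in> points (\<Gamma> p b)" for x m m'
  proof -
    have x: "x \<in> trace p b" using that points_\<Gamma> by blast
    then have px: "p \<sim> x" "p \<noteq> x" using trace_ne[OF pb x] by (simp_all add: trace_def)
    note J = join_line[OF px]
    \<comment> \<open>Three planes through \<open>px\<close> cut the trace in three different lines
      through \<open>x\<close>.\<close>
    have "\<exists>A B C. distinct [A, B, C] \<and> (\<forall>S\<in>{A, B, C}. is_plane \<Delta> S \<and> join \<Delta> p x \<subseteq> S)"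
      using thick J(1) unfolding thick_def by (rule bspec)
    then obtain A B C where ABC: "distinct [A, B, C]"
      "\<forall>S\<in>{A, B, C}. is_plane \<Delta> S \<and> join \<Delta> p x \<subseteq> S"
      by (elim exE conjE) (rule that)
    have "\<exists>l. l \<in> lines (\<Gamma> p b) \<and> x \<in> l \<and> S = (\<Union>r\<in>l. join \<Delta> p r)" if "S \<in> {A, B, C}" for S
      
    proof -
      have "is_plane \<Delta> S" "p \<in> S" "x \<in> S" using ABC(2) that J by blast+
      then show ?thesis using plane_trace[OF _ _ _ x pb] by metis
    qed
    then obtain l1 l2 l3 where l:
      "l1 \<in> lines (\<Gamma> p b)" "x \<in> l1" "A = (\<Union>r\<in>l1. join \<Delta> p r)"
      "l2 \<in> lines (\<Gamma> p b)" "x \<in> l2" "B = (\<Union>r\<in>l2. join \<Delta> p r)"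
      "l3 \<in> lines (\<Gamma> p b)" "x \<in> l3" "C = (\<Union>r\<in>l3. join \<Delta> p r)"
      by (metis insertI1 insertI2)
    have "l1 \<noteq> l2" "l1 \<noteq> l3" "l2 \<noteq> l3" using ABC(1) l(3,6,9) by auto
    then show ?thesis using l(1,2,4,5,7,8) by metis
  qed
qed

end

section \<open>Line elations as projectivities\<close>

text \<open>Excluding \<open>d\<close> for \<open>r\<close> and \<open>q\<close> for
  \<open>s\<close> is what makes consecutive points of the chain \<open>p\<close>, \<open>b\<close>,
  \<open>r\<close>, \<open>s\<close>, \<open>p\<close> opposite: \<open>d\<close> is collinear to
  \<open>b\<close>, and \<open>q\<close> to \<open>p\<close> and \<open>r\<close>.\<close>

locale elation_points = thick_polar_three +
  fixes p b d q r s :: 'a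
  assumes pb: "opposite \<Delta> p b"
    and d: "d \<in> trace p b" and q: "q \<in> trace p b" and dq: "d \<sim> q" "d \<noteq> q"
    and r: "r \<in> join \<Delta> p d" "r \<noteq> d" and s: "s \<in> join \<Delta> b q" "s \<noteq> q"
begin

lemma collinear_flag: "p \<sim> d" "p \<sim> q" "b \<sim> d" "b \<sim> q" "p \<noteq> d" "b \<noteq> q"
  using d q trace_ne[OF pb] by (auto simp: trace_def)

lemma collinear_r: "p \<sim> x \<Longrightarrow> d \<sim> x \<Longrightarrow> r \<sim> x"
  using perp_join[OF collinear_flag(1,5) _ _ r(1), of x] perp_sym by blast

lemma collinear_s: "b \<sim> x \<Longrightarrow> q \<sim> x \<Longrightarrow> s \<sim> x"
  using perp_join[OF collinear_flag(4,6) _ _ s(1), of x] perp_sym by blast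

lemma br: "opposite \<Delta> b r"
  using opposite_on_line[OF opposite_sym[OF pb] collinear_flag(1,3) r] .

lemma rs: "opposite \<Delta> r s"
  using opposite_on_line[OF opposite_sym[OF br] collinear_flag(4) _ s]
    collinear_r[OF collinear_flag(2) dq(1)] .

lemma sp: "opposite \<Delta> s p"
  using opposite_sym[OF opposite_on_line[OF pb collinear_flag(4,2) s]] .

text \<open>The projection from \<open>p\<close> to \<open>b\<close> needs no foot, as
  \<open>x\<close> is already collinear to \<open>b\<close>. The outermost foot only moves the
  result along its line through \<open>p\<close> back into the trace. The default \<open>x\<close>
  serves \<open>permutes\<close>.\<close>

definition elation :: "'a \<Rightarrow> 'a" where
  "elation x = (if x \<in> trace p b
     then foot \<Delta> p b (foot \<Delta> s p (foot \<Delta> r s (foot \<Delta> b r x))) else x)"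

lemma elation_chain:
  assumes "x \<in> trace p b"
  shows "foot \<Delta> b r x \<in> trace b r" "foot \<Delta> r s (foot \<Delta> b r x) \<in> trace r s"
    "foot \<Delta> s p (foot \<Delta> r s (foot \<Delta> b r x)) \<in> trace s p" "elation x \<in> trace p b"
proof -
  show 1: "foot \<Delta> b r x \<in> trace b r" using foot_trace(1)[OF pb br assms] .
  show 2: "foot \<Delta> r s (foot \<Delta> b r x) \<in> trace r s" using foot_trace(1)[OF br rs 1] .
  show 3: "foot \<Delta> s p (foot \<Delta> r s (foot \<Delta> b r x)) \<in> trace s p" using foot_trace(1)[OF rs sp 2] .
  show "elation x \<in> trace p b" using foot_trace(1)[OF sp pb 3] assms by (simp add: elation_def)
qed

lemma elation_permutes: "elation permutes trace p b"
proof (rule bij_imp_permutes)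
  have "bij_betw (foot \<Delta> p b \<circ> (foot \<Delta> s p \<circ> (foot \<Delta> r s \<circ> foot \<Delta> b r))) (trace p b) (trace p b)"
    using foot_bij_betw pb br rs sp bij_betw_trans by metis
  then show "bij_betw elation (trace p b) (trace p b)"
    by (rule bij_betw_cong[THEN iffD1, rotated]) (simp add: elation_def)
qed (simp add: elation_def)

lemma elation_collinear_iff:
  assumes x: "x \<in> trace p b" and y: "y \<in> trace p b"
  shows "elation x \<sim> elation y \<longleftrightarrow> x \<sim> y"
  using foot_trace_collinear_iff[OF pb br x y]
    foot_trace_collinear_iff[OF br rs elation_chain(1)[OF x] elation_chain(1)[OF y]]
    foot_trace_collinear_iff[OF rs sp elation_chain(2)[OF x] elation_chain(2)[OF y]]
    foot_trace_collinear_iff[OF sp pb elation_chain(3)[OF x] elation_chain(3)[OF y]]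
  by (simp add: elation_def x y)

lemma collineation_elation: "collineation (\<Gamma> p b) elation"
proof -
  interpret gen_quad "\<Gamma> p b" using gen_quad_\<Gamma>[OF pb] .
  show ?thesis
    by (rule collineationI)
      (use elation_permutes elation_collinear_iff elation_chain(4) in
        \<open>auto simp: points_\<Gamma> collinear_\<Gamma>\<close>)
qed

lemma elation_projectivity:
  assumes x: "x \<in> trace p b"
  shows "join \<Delta> p (elation x) =
    (proj \<Delta> s p \<circ> proj \<Delta> r s \<circ> proj \<Delta> b r \<circ> proj \<Delta> p b) (join \<Delta> p x)"
proof -
  let ?x1 = "foot \<Delta> b r x" let ?x2 = "foot \<Delta> r s ?x1" let ?x3 = "foot \<Delta> s p ?x2"
  have c: "p \<sim> x" "b \<sim> x" "p \<noteq> x" "b \<noteq> x" using x trace_ne[OF pb x] by (auto simp: trace_def)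
  have c1: "r \<sim> ?x1" "r \<noteq> ?x1" using elation_chain(1)[OF x] trace_ne[OF br] by (auto simp: trace_def)
  have c2: "s \<sim> ?x2" "s \<noteq> ?x2" using elation_chain(2)[OF x] trace_ne[OF rs] by (auto simp: trace_def)
  have c3: "p \<sim> ?x3" "p \<noteq> ?x3" using elation_chain(3)[OF x] trace_ne[OF sp] by (auto simp: trace_def)
  have "foot \<Delta> p b x = x" using foot_id[OF pb] c perp_sym by blast
  then have "(proj \<Delta> s p \<circ> proj \<Delta> r s \<circ> proj \<Delta> b r \<circ> proj \<Delta> p b) (join \<Delta> p x) = join \<Delta> p ?x3"
    by (simp add: proj_join[OF pb] proj_join[OF br] proj_join[OF rs] proj_join[OF sp] c c1 c2)
  then show ?thesis using join_foot[OF pb c3] x by (simp add: elation_def)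
qed

text \<open>A point of \<open>dq\<close> is collinear to all four points of the chain, so it is its
  own foot at every stage.\<close>

lemma elation_fixes_flag_line:
  assumes x: "x \<in> join \<Delta> d q"
  shows "elation x = x"
proof -
  have c: "p \<sim> x" "b \<sim> x" "d \<sim> x" "q \<sim> x"
    using perp_join[OF dq _ _ x] collinear_flag line_collinear[OF join_line(1)[OF dq] _ x]
      join_line(2,3)[OF dq] by blast+
  have t: "x \<in> trace p b" "x \<in> trace b r" "x \<in> trace r s" "x \<in> trace s p"
    using c collinear_r collinear_s by (auto simp: trace_def)
  have ne: "p \<noteq> x" "b \<noteq> x" "r \<noteq> x" "s \<noteq> x" using trace_ne pb rs t by blast+
  show ?thesis using t ne perp_sym
    by (simp add: elation_def trace_def foot_id[OF br] foot_id[OF rs] foot_id[OF sp] foot_id[OF pb])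
qed

text \<open>This makes the lines through \<open>d\<close> and \<open>q\<close> stabilized: the image
  of \<open>x\<close> is collinear to \<open>x\<close> and to the fixed point \<open>d\<close> or
  \<open>q\<close>, so the absence of triangles keeps it on their line.\<close>

lemma elation_collinear_self:
  assumes x: "x \<in> trace p b" and xdq: "d \<sim> x \<or> q \<sim> x"
  shows "elation x \<sim> x"
proof -
  let ?x1 = "foot \<Delta> b r x" let ?x2 = "foot \<Delta> r s ?x1" let ?x3 = "foot \<Delta> s p ?x2"
  have c: "p \<sim> x" "b \<sim> x" "p \<noteq> x" "b \<noteq> x" using x trace_ne[OF pb x] by (auto simp: trace_def)
  note F1 = foot[OF br c(2,4)]
  have c1: "b \<sim> ?x1" "r \<sim> ?x1" "r \<noteq> ?x1"
    using elation_chain(1)[OF x] trace_ne[OF br] by (auto simp: trace_def)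
  have c2: "r \<sim> ?x2" "s \<sim> ?x2" "s \<noteq> ?x2"
    using elation_chain(2)[OF x] trace_ne[OF rs] by (auto simp: trace_def)
  have c3: "s \<sim> ?x3" "p \<sim> ?x3" "p \<noteq> ?x3"
    using elation_chain(3)[OF x] trace_ne[OF sp] by (auto simp: trace_def)
  note F2 = foot[OF rs c1(2,3)]
  note F3 = foot[OF sp c2(2,3)]
  note F4 = foot[OF pb c3(2,3)]
  have "x \<sim> ?x3"
    using xdq
  proof
    \<comment> \<open>The first foot is trivial because \<open>r\<close> is collinear to
      \<open>x\<close>. The third is trivial because \<open>p\<close> is collinear to
      \<open>r\<close> and \<open>x\<close>, hence to the second foot on \<open>rx\<close>.\<close>
    assume dx: "d \<sim> x"
    have rx: "r \<sim> x" "r \<noteq> x" using collinear_r[OF c(1) dx] opposite_not_collinear[OF br] c by auto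
    have x1: "?x1 = x" using foot_id[OF br c(2,4)] rx perp_sym by blast
    have "p \<sim> r" using perp_sym[OF collinear_r[OF _ perp_sym[OF collinear_flag(1)]]]
        collinear_flag(1) by (auto simp: collinear_def)
    then have "p \<sim> ?x2" using perp_join[OF rx _ c(1), of ?x2] F2(1) x1 by simp
    then have "?x3 = ?x2" using foot_id[OF sp c2(2,3)] perp_sym by blast
    then show ?thesis
      using line_collinear[OF join_line(1)[OF rx] join_line(3)[OF rx], of ?x2] F2(1) x1 by simp
  next
    \<comment> \<open>The second foot is trivial: \<open>s\<close> is collinear to all of
      \<open>bx\<close>, which contains the first foot. As \<open>x\<close> is collinear to both
      that foot and \<open>s\<close>, it is collinear to the third foot on their join.\<close>
    assume qx: "q \<sim> x"
    have "s \<sim> ?x1"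
      using collinear_s[OF c1(1)] perp_join[OF c(2,4) _ qx F1(1)] collinear_flag(4) perp_sym by blast
    then have x2: "?x2 = ?x1" using foot_id[OF rs c1(2,3)] perp_sym by blast
    have "x \<sim> ?x1" using line_collinear[OF join_line(1,3)[OF c(2,4)] F1(1)] .
    moreover have "x \<sim> s" using collinear_s c(2) qx perp_sym by blast
    ultimately show ?thesis using perp_join[OF c2(2,3) _ _ F3(1), of x] x2 by simp
  qed
  then have "x \<sim> foot \<Delta> p b ?x3" using perp_join[OF c3(2,3) _ _ F4(1)] c(1) perp_sym by blast
  then show ?thesis using x perp_sym by (simp add: elation_def)
qed

lemma line_elation_elation: "line_elation (\<Gamma> p b) d q elation"
proof -
  interpret G: gen_quad "\<Gamma> p b" using gen_quad_\<Gamma>[OF pb] .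
  have J: "join (\<Gamma> p b) d q = join \<Delta> d q" using join_\<Gamma>[OF d q dq] .
  have fix_dq: "elation d = d" "elation q = q"
    using elation_fixes_flag_line join_line[OF dq] by blast+
  have "elation ` l = l" if l: "l \<in> lines (\<Gamma> p b)" and e: "e = d \<or> e = q" "e \<in> l" for l e
  proof -
    have l': "l \<in> lines \<Delta>" "l \<subseteq> trace p b" using l lines_\<Gamma> by blast+
    have ee: "elation e = e" using e fix_dq by blast
    have sub: "elation ` l \<subseteq> l"
    proof clarify
      fix x assume x: "x \<in> l"
      show "elation x \<in> l"
      proof (cases "x = e")
        case True then show ?thesis using ee x by simp
      next
        case False
        have xt: "x \<in> trace p b" using l' x by blast
        have ex: "e \<sim> x" using line_collinear[OF l'(1) e(2) x] .
        then have "elation x \<sim> x" using elation_collinear_self[OF xt] e(1) by blast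
        moreover have "elation x \<sim> e"
          using elation_collinear_iff[OF xt, of e] ee ex l' e(2) perp_sym by auto
        ultimately have "collinear (\<Gamma> p b) (elation x) x" "collinear (\<Gamma> p b) (elation x) e"
          using collinear_\<Gamma> elation_chain(4)[OF xt] xt l' e(2) by auto
        then show ?thesis using G.no_triangle[OF l x e(2) False] by blast
      qed
    qed
    \<comment> \<open>The image of \<open>l\<close> is a line sharing the two points
      \<open>elation x\<close> and \<open>e\<close> with \<open>l\<close>.\<close>
    obtain x where x: "x \<in> l" "x \<noteq> e" using third_point l' by blast
    have "elation x \<noteq> e" using permutes_inj[OF elation_permutes] x(2) ee by (metis injD)
    moreover have "e \<in> elation ` l" using ee e(2) by (metis imageI)
    ultimately show ?thesis
      using G.line_unique[OF G.collineation_line[OF collineation_elation l] l, of "elation x" e]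
        sub x e(2) by blast
  qed
  then show ?thesis
    using dq d q collineation_elation elation_fixes_flag_line J by (auto simp: line_elation_def collinear_\<Gamma>)
qed

end

section \<open>Transitivity of the elations and the two conclusions\<close>

context thick_polar_three
begin

text \<open>The elation is returned together with its factorization, since the Moufang property
  needs the former and the projectivity claim the latter.\<close>

lemma line_elation_transitive:
  assumes pb: "opposite \<Delta> p b" and d: "d \<in> trace p b" and q: "q \<in> trace p b" and u: "u \<in> trace p b"
    and dq: "d \<sim> q" and qu: "q \<sim> u" and du: "\<not> d \<sim> u" and v: "v \<in> join \<Delta> q u" "v \<noteq> q"
  obtains \<theta> r s where "line_elation (\<Gamma> p b) d q \<theta>" "\<theta> u = v"
    "opposite \<Delta> b r" "opposite \<Delta> r s" "opposite \<Delta> s p"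
    "\<And>x. x \<in> trace p b \<Longrightarrow> join \<Delta> p (\<theta> x) =
      (proj \<Delta> s p \<circ> proj \<Delta> r s \<circ> proj \<Delta> b r \<circ> proj \<Delta> p b) (join \<Delta> p x)"
proof -
  have ne: "d \<noteq> q" "q \<noteq> u" using du dq qu perp_sym d by (auto simp: trace_def dest: collinear_points collinear_refl)
  have c: "p \<sim> d" "p \<sim> q" "p \<sim> u" "b \<sim> d" "b \<sim> q" "b \<sim> u" using d q u by (auto simp: trace_def)
  have cne: "p \<noteq> d" "b \<noteq> q" "b \<noteq> u" using trace_ne[OF pb] d q u by blast+
  note PD = join_line[OF c(1) cne(1)]
  note M = join_line[OF qu ne(2)]
  note BU = join_line[OF c(6) cne(3)]
  note BQ = join_line[OF c(5) cne(2)]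
  \<comment> \<open>Choosing \<open>r\<close> different from \<open>p\<close> forces
    \<open>y\<close> off \<open>qu\<close>: if \<open>y\<close> were \<open>u\<close>, then
    \<open>u\<close> would be collinear to \<open>r\<close> and \<open>p\<close>, hence to
    \<open>d\<close>.\<close>
  obtain r where r: "r \<in> join \<Delta> p d" "r \<noteq> p" "r \<noteq> d" using third_point[OF PD(1)] by blast
  have br: "opposite \<Delta> b r" using opposite_on_line[OF opposite_sym[OF pb] c(1,4) r(1,3)] .
  define y where "y = foot \<Delta> b r u"
  note y = foot[OF br c(6) cne(3), folded y_def]
  have pv: "p \<sim> v" "b \<sim> v" using perp_join[OF qu ne(2) _ _ v(1)] c by blast+
  have bM: "b \<notin> join \<Delta> q u"
    using perp_join[OF qu ne(2) c(2,3)] opposite_not_collinear[OF pb] by blast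
  have "y \<noteq> u"
  proof
    assume "y = u"
    then have "u \<sim> d" using perp_line[OF PD(1) r(1) PD(2) r(2) _ _ PD(3)] y(2) c perp_sym by blast
    then show False using du perp_sym by blast
  qed
  then have yM: "y \<notin> join \<Delta> q u" using line_unique[OF BU(1) M(1), of y u] y(1) BU M bM by blast
  then have vy: "v \<noteq> y" using v by blast
  have by_v: "y \<sim> v"
    using perp_join[OF c(6) cne(3) _ _ y(1), of v] line_collinear[OF M(1) v(1) M(3)] pv perp_sym by blast
  note VY = join_line[OF perp_sym[OF by_v] vy]
  \<comment> \<open>Both \<open>b\<close> and \<open>q\<close> are collinear to \<open>v\<close> and
    \<open>y\<close>, so the lines \<open>vy\<close> and \<open>bq\<close> are mutually collinear
    and meet.\<close>
  have "x \<sim> z" if x: "x \<in> join \<Delta> v y" and z: "z \<in> join \<Delta> b q" for x z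
  proof -
    have "q \<sim> v" using line_collinear[OF M(1,2) v(1)] .
    moreover have "q \<sim> y" using perp_join[OF c(6) cne(3) _ qu y(1)] c perp_sym by blast
    ultimately have "q \<sim> x" "b \<sim> x"
      using perp_join[OF perp_sym[OF by_v] vy _ _ x] pv y(3) by blast+
    then show ?thesis using perp_join[OF c(5) cne(2) _ _ z] perp_sym by blast
  qed
  then obtain s where s: "s \<in> join \<Delta> v y" "s \<in> join \<Delta> b q"
    using collinear_lines_meet VY BQ by blast
  have sq: "s \<noteq> q"
  proof
    assume "s = q"
    then have "join \<Delta> v y = join \<Delta> q u"
      using line_unique[OF VY(1) M(1) v(2)] VY v M s by blast
    then show False using VY yM by blast
  qed
  interpret E: elation_points \<Delta> p b d q r s
    by unfold_locales (use pb d q dq ne r s sq in auto)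
  \<comment> \<open>The path of \<open>u\<close>: its foot on \<open>bu\<close> is \<open>y\<close>,
    which is already collinear to \<open>s\<close>. The line \<open>sy\<close> equals
    \<open>vy\<close>, and its point collinear to \<open>p\<close> is \<open>v\<close>, which lies
    in the trace.\<close>
  have "s \<sim> y" using line_collinear[OF VY(1) s(1) VY(3)] .
  have r_y: "r \<sim> y" "r \<noteq> y" using y perp_sym opposite_not_collinear[OF br] by auto
  have x2: "foot \<Delta> r s y = y" using foot_id[OF E.rs r_y] \<open>s \<sim> y\<close> perp_sym by blast
  have "s \<noteq> y"
  proof
    assume "s = y"
    then show False using opposite_not_collinear[OF E.rs] r_y by blast
  qed
  then have "join \<Delta> s y = join \<Delta> v y" using join_eq[OF VY(1) s(1) VY(3)] by blast
  then have x3: "foot \<Delta> s p y = v"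
    using foot_eqI[OF E.sp \<open>s \<sim> y\<close> \<open>s \<noteq> y\<close>, of v] VY pv perp_sym by simp
  have "p \<noteq> v" using pv opposite_not_collinear[OF pb] by blast
  then have "foot \<Delta> p b v = v" using foot_id[OF pb pv(1)] pv perp_sym by blast
  then have "E.elation u = v" using u x2 x3 by (simp add: E.elation_def y_def)
  then show ?thesis using that E.line_elation_elation br E.rs E.sp E.elation_projectivity by blast
qed

lemma moufang_\<Gamma>:
  assumes pb: "opposite \<Delta> p b" and quad: "quadrangle (\<Gamma> p b) d q u n"
  shows "moufang_second_kind_root (\<Gamma> p b) d q u n"
proof -
  interpret G: gen_quad "\<Gamma> p b" using gen_quad_\<Gamma>[OF pb] .
  have t: "d \<in> trace p b" "q \<in> trace p b" "u \<in> trace p b" and dq: "d \<sim> q" and qu: "q \<sim> u"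
    and du: "\<not> d \<sim> u"
    using quad by (auto simp: quadrangle_def collinear_\<Gamma>)
  have ne: "d \<noteq> q" "q \<noteq> u" using du dq qu by auto
  note M = join_line[OF qu ne(2)]
  have JM: "join (\<Gamma> p b) q u = join \<Delta> q u" using join_\<Gamma>[OF t(2,3) qu ne(2)] .
  have MG: "join \<Delta> q u \<in> lines (\<Gamma> p b)" using line_\<Gamma>I[OF M ne(2) t(2,3)] .
  show ?thesis
  proof (rule G.moufang_second_kind_rootI[OF quad])
    fix u1 u2 assume "u1 \<in> join (\<Gamma> p b) q u" "u1 \<noteq> q" "u2 \<in> join (\<Gamma> p b) q u" "u2 \<noteq> q"
    then have 1: "u1 \<in> join \<Delta> q u" "u1 \<noteq> q" and 2: "u2 \<in> join \<Delta> q u" "u2 \<noteq> q"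
      using JM by simp_all
    have u1: "u1 \<in> trace p b" using MG 1 lines_\<Gamma> by blast
    have qu1: "q \<sim> u1" using line_collinear[OF M(1,2) 1(1)] .
    \<comment> \<open>The transitivity lemma is applied with \<open>u1\<close> in place of
      \<open>u\<close>, so \<open>u1\<close> must inherit non-collinearity to
      \<open>d\<close>.\<close>
    have "\<not> d \<sim> u1" using perp_line[OF M(1,2) 1(1) _ dq _ M(3)] 1(2) du by blast
    moreover have "join \<Delta> q u1 = join \<Delta> q u" using join_eq[OF M(1,2) 1(1)] 1(2) by blast
    ultimately show "\<exists>\<theta>. line_elation (\<Gamma> p b) d q \<theta> \<and> \<theta> u1 = u2"
      using line_elation_transitive[OF pb t(1,2) u1 dq qu1, of u2] 2 by metis
  qed
qed

lemma line_elation_projectivity: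
  assumes pb: "opposite \<Delta> p b" and \<theta>: "line_elation (\<Gamma> p b) d q \<theta>"
  obtains r s where "opposite \<Delta> b r" "opposite \<Delta> r s" "opposite \<Delta> s p"
    "\<And>x. x \<in> trace p b \<Longrightarrow> join \<Delta> p (\<theta> x) =
      (proj \<Delta> s p \<circ> proj \<Delta> r s \<circ> proj \<Delta> b r \<circ> proj \<Delta> p b) (join \<Delta> p x)"
proof -
  interpret G: gen_quad "\<Gamma> p b" using gen_quad_\<Gamma>[OF pb] .
  have dq: "d \<noteq> q" "collinear (\<Gamma> p b) d q" and col: "collineation (\<Gamma> p b) \<theta>"
    using \<theta> by (auto simp: line_elation_def)
  have t: "d \<in> trace p b" "q \<in> trace p b" "d \<sim> q" using dq by (auto simp: collinear_\<Gamma>)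
  note L = G.join_line[OF dq(2,1)]
  obtain M where M: "M \<in> lines (\<Gamma> p b)" "q \<in> M" "M \<noteq> join (\<Gamma> p b) d q"
    using G.third_line[of q "join (\<Gamma> p b) d q"] t(2) unfolding points_\<Gamma> by blast
  obtain u where u: "u \<in> M" "u \<noteq> q" using G.third_point[OF M(1)] by blast
  have MD: "M \<in> lines \<Delta>" "M \<subseteq> trace p b" using M lines_\<Gamma> by blast+
  have ut: "u \<in> trace p b" and qu: "q \<sim> u" using MD M u line_collinear by blast+
  have dM: "d \<notin> M" using G.line_unique[OF M(1) L(1) dq(1)] M L by blast
  have nG: "\<not> collinear (\<Gamma> p b) d u"
    using G.no_triangle[OF M(1) u(1) M(2) u(2)] dM dq by blast
  then have du: "\<not> d \<sim> u" using collinear_\<Gamma> t ut by blast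
  \<comment> \<open>Since \<open>\<theta>\<close> fixes \<open>q\<close> and stabilizes
    \<open>M\<close>, the image of \<open>u\<close> is an admissible target \<open>v\<close>, and
    the constructed \<open>\<psi>\<close> agrees with \<open>\<theta>\<close> at
    \<open>u\<close>.\<close>
  have "\<theta> q = q" "\<theta> ` M = M" using \<theta> M L by (auto simp: line_elation_def)
  then have v: "\<theta> u \<in> M" "\<theta> u \<noteq> q" using u G.collineation_inj[OF col] by (auto dest: injD)
  have "join \<Delta> q u = M" using join_eq[OF MD(1) M(2) u(1)] u(2) by blast
  then obtain \<psi> r s where \<psi>: "line_elation (\<Gamma> p b) d q \<psi>" "\<psi> u = \<theta> u"
    and opp: "opposite \<Delta> b r" "opposite \<Delta> r s" "opposite \<Delta> s p"
    and pr: "\<And>x. x \<in> trace p b \<Longrightarrow> join \<Delta> p (\<psi> x) =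
      (proj \<Delta> s p \<circ> proj \<Delta> r s \<circ> proj \<Delta> b r \<circ> proj \<Delta> p b) (join \<Delta> p x)"
    using line_elation_transitive[OF pb t(1,2) ut t(3) qu du, of "\<theta> u"] v by metis
  have "collinear (\<Gamma> p b) q u" using collinear_\<Gamma> t ut qu by blast
  then have "\<theta> x = \<psi> x" if "x \<in> trace p b" for x
    using G.line_elation_eqI[OF \<theta> \<psi>(1) _ nG \<psi>(2)[symmetric]] that points_\<Gamma> by blast
  then show ?thesis using that opp pr by metis
qed

end

theorem lemma4p1:
  fixes \<Delta> \<Gamma> :: "'a geometry" and p b :: 'a
  assumes "polar_space \<Delta>" and "rank_three \<Delta>" and "thick \<Delta>"
    and "opposite \<Delta> p b"
    and "\<Gamma> = perp_quadrangle \<Delta> p b"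
  shows "(\<forall>d q u n. quadrangle \<Gamma> d q u n \<longrightarrow> moufang_second_kind_root \<Gamma> d q u n) \<and>
    (\<forall>d q \<theta>. line_elation \<Gamma> d q \<theta> \<longrightarrow>
      (\<exists>p\<^sub>1 p\<^sub>2 p\<^sub>3.
        opposite \<Delta> p p\<^sub>1 \<and> opposite \<Delta> p\<^sub>1 p\<^sub>2 \<and> opposite \<Delta> p\<^sub>2 p\<^sub>3 \<and> opposite \<Delta> p\<^sub>3 p \<and>
        (\<forall>x\<in>points \<Gamma>. join \<Delta> p (\<theta> x) =
          (proj \<Delta> p\<^sub>3 p \<circ> proj \<Delta> p\<^sub>2 p\<^sub>3 \<circ> proj \<Delta> p\<^sub>1 p\<^sub>2 \<circ> proj \<Delta> p p\<^sub>1) (join \<Delta> p x))))"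
proof -
  interpret thick_polar_three \<Delta> by unfold_locales (use assms in auto)
  \<comment> \<open>The intermediate points are \<open>b\<close>, \<open>r\<close> and
    \<open>s\<close>, in this order.\<close>
  show ?thesis unfolding assms(5) points_\<Gamma>
    using moufang_\<Gamma>[OF assms(4)] line_elation_projectivity[OF assms(4)] assms(4) by metis
qed

end
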